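(* Assume that the function $S$ is not identically zero on any (nondegenerate) subrectangle of $D$. Then \[ \overline{\dim}_B\,\Gamma f\;\le\;\max\Big\{2,\;1+\frac{\log\rho^*}{\log N}\Big\}. \]
   Context: Grid. Let $N\ge 2$ be an integer, and let $x_0<x_1<\cdots<x_N$ and $y_0<y_1<\cdots<y_N$ be real numbers with $x_i-x_{i-1}=(x_N-x_0)/N$ and $y_i-y_{i-1}=(y_N-y_0)/N$ for $1\le i\le N$, and $x_N-x_0=y_N-y_0$. Put $I=[x_0,x_N]$, $J=[y_0,y_N]$, $D=I\times J$, $I_i=[x_{i-1},x_i]$, $J_j=[y_{j-1},y_j]$. For $1\le i\le N$ let $u_i:I\to I_i$ be the affine map with $u_i(x_0)=x_{i-1}$, $u_i(x_N)=x_i$ if $i$ is odd, and $u_i(x_0)=x_i$, $u_i(x_N)=x_{i-1}$ if $i$ is even; let $v_j:J\to J_j$ be the affine map with $v_j(y_0)=y_{j-1}$, $v_j(y_N)=y_j$ if $j$ is odd, and $v_j(y_0)=y_j$, $v_j(y_N)=y_{j-1}$ if $j$ is even. Let $\Sigma=\{1,\dots,N\}\times\{1,\dots,N\}$. For $w=(i,j)\in\Sigma$ let $D_w=I_i\times J_j$ and $L_w:D\to D_w$, $L_w(x,y)=(u_i(x),v_j(y))$. The function $f$. Let $z_{ij}\in\mathbb{R}$ ($0\le i,j\le N$) be given. Let $g,h,S:D\to\mathbb{R}$ be continuous with $g(x_i,y_j)=z_{ij}$ for $i,j\in\{0,N\}$, $h(x_i,y_j)=z_{ij}$ for all $0\le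 i,j\le N$, and $|S(x,y)|<1$ for all $(x,y)\in D$. Define $q:D\to\mathbb{R}$ by $q(x,y)=h(x,y)-S(x,y)\,g(L_w^{-1}(x,y))$ for $(x,y)\in D_w$, $w\in\Sigma$ (this is well defined and continuous). For $w=(i,j)\in\Sigma$ let $F_w(x,y,z)=S(L_w(x,y))\,z+q(L_w(x,y))$ and $\Psi_w(x,y,z)=(u_i(x),v_j(y),F_w(x,y,z))$ on $D\times\mathbb{R}$. It is known that there is a unique continuous $f:D\to\mathbb{R}$ with $f(x_i,y_j)=z_{ij}$ for all $0\le i,j\le N$ whose graph $\Gamma f=\{(x,y,f(x,y)):(x,y)\in D\}$ satisfies $\Gamma f=\bigcup_{w\in\Sigma}\Psi_w(\Gamma f)$; thus $f(x,y)=S(x,y)f(L_w^{-1}(x,y))+q(x,y)$ for $(x,y)\in D_w$. $\Gamma f$ is called a generalized affine fractal interpolation surface and $S$ its vertical scaling function. Assume that $S$ and $q$ are Lipschitz on $D$: there are $\lambda_S,\lambda_q>0$ with $|S(t_1)-S(t_2)|\le\lambda_S|t_1-t_2|$ and $|q(t_1)-q(t_2)|\le\lambda_q|t_1-t_2|$ for all $t_1,t_2\in D$. Words. For $n\ge1$, $\Sigma^n$ is the set of words $\mathbf w=w_1\cdots w_n$ with letters in $\Sigma$; $\Sigma^0$ consists of the empty word. For $\mathbf w=w_1\cdots w_n\in\Sigma^n$ put $\sigma(\mathbf w)=w_2\cdots w_n\in\Sigma^{n-1}$, $L_{\mathbf w}=L_{w_1}\circ\cdots\circ L_{w_n}$,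 $D_{\mathbf w}=L_{\mathbf w}(D)$. Juxtaposition denotes concatenation. Vertical scaling matrix and $\rho^*$. For a word $\mathbf w$ put $\overline s_{\mathbf w}=\sup_{t\in D_{\mathbf w}}|S(t)|$. For $n\ge1$, $\overline M_n$ is the $\Sigma^n\times\Sigma^n$ matrix with $(\overline M_n)_{\mathbf i,\mathbf j}=\overline s_{\mathbf i j_n}$ if $\sigma(\mathbf i)=j_1\cdots j_{n-1}$ and $0$ otherwise, where $\mathbf i=i_1\cdots i_n$, $\mathbf j=j_1\cdots j_n$. With $\rho(A)$ denoting the spectral radius of a square matrix $A$, it is known that $\rho(\overline M_n)$ is nonincreasing in $n$; put $\rho^*=\lim_{n\to\infty}\rho(\overline M_n)$. Convention: $\log 0=-\infty$. Box dimension. For $\varepsilon>0$ and bounded $E\subset\mathbb{R}^d$, let $\mathcal N_E(\varepsilon)$ be the number of cubes $\prod_{i=1}^d[n_i\varepsilon,(n_i+1)\varepsilon]$, $n_i\in\mathbb{Z}$, intersecting $E$; $\overline{\dim}_B E=\varlimsup_{\varepsilon\to0}\frac{\log\mathcal N_E(\varepsilon)}{\log(1/\varepsilon)}$. *)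

theory Defs
  imports "HOL-Analysis.Analysis" "Jordan_Normal_Form.Spectral_Radius"
begin

text \<open>Logarithm with the convention log 0 = -\<infinity>; used on nonnegative arguments only.\<close>

definition elog :: "real \<Rightarrow> ereal" where
  "elog t = (if t \<le> 0 then -\<infinity> else ereal (ln t))"


subsection \<open>Upper box dimension\<close>

definition grid_cube :: "real \<Rightarrow> ('a \<Rightarrow> int) \<Rightarrow> 'a :: euclidean_space set" where
  "grid_cube \<epsilon> n = cbox (\<Sum>b\<in>Basis. (of_int (n b) * \<epsilon>) *\<^sub>R b)
                        (\<Sum>b\<in>Basis. ((of_int (n b) + 1) * \<epsilon>) *\<^sub>R b)"

text \<open>The cubes are counted as sets, so the values of the index function off the standard
  basis play no role.\<close>

definition box_count :: "'a :: euclidean_space set \<Rightarrow> real \<Rightarrow> nat" where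
  "box_count E \<epsilon> = card {Q. (\<exists>n. Q = grid_cube \<epsilon> n) \<and> Q \<inter> E \<noteq> {}}"

definition upper_box_dim :: "'a :: euclidean_space set \<Rightarrow> ereal" where
  "upper_box_dim E = Limsup (at_right 0) (\<lambda>\<epsilon>. elog (real (box_count E \<epsilon>)) / ereal (ln (1 / \<epsilon>)))"


subsection \<open>Grid and contractions\<close>

definition uniform_nodes :: "nat \<Rightarrow> (nat \<Rightarrow> real) \<Rightarrow> bool" where
  "uniform_nodes N x \<longleftrightarrow>
     (\<forall>i\<in>{1..N}. x (i - 1) < x i \<and> x i - x (i - 1) = (x N - x 0) / real N)"

definition dom_rect :: "nat \<Rightarrow> (nat \<Rightarrow> real) \<Rightarrow> (nat \<Rightarrow> real) \<Rightarrow> (real \<times> real) set" where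
  "dom_rect N x y = {x 0..x N} \<times> {y 0..y N}"

definition letters :: "nat \<Rightarrow> (nat \<times> nat) set" where
  "letters N = {1..N} \<times> {1..N}"

definition cell :: "(nat \<Rightarrow> real) \<Rightarrow> (nat \<Rightarrow> real) \<Rightarrow> nat \<times> nat \<Rightarrow> (real \<times> real) set" where
  "cell x y w = {x (fst w - 1)..x (fst w)} \<times> {y (snd w - 1)..y (snd w)}"

text \<open>The affine map taking \<open>a\<close> to \<open>c\<close> and \<open>b\<close> to \<open>d\<close>.\<close>

definition affine_map :: "real \<Rightarrow> real \<Rightarrow> real \<Rightarrow> real \<Rightarrow> real \<Rightarrow> real" where
  "affine_map a b c d t = c + (d - c) * (t - a) / (b - a)"

text \<open>This is \<open>u\<^sub>i\<close> for the nodes \<open>x\<close> and \<open>v\<^sub>i\<close> for the nodes \<open>y\<close>.\<close>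

definition edge_map :: "nat \<Rightarrow> (nat \<Rightarrow> real) \<Rightarrow> nat \<Rightarrow> real \<Rightarrow> real" where
  "edge_map N x i =
     (if odd i then affine_map (x 0) (x N) (x (i - 1)) (x i)
      else affine_map (x 0) (x N) (x i) (x (i - 1)))"

definition L_map ::
  "nat \<Rightarrow> (nat \<Rightarrow> real) \<Rightarrow> (nat \<Rightarrow> real) \<Rightarrow> nat \<times> nat \<Rightarrow> real \<times> real \<Rightarrow> real \<times> real" where
  "L_map N x y w p = (edge_map N x (fst w) (fst p), edge_map N y (snd w) (snd p))"


subsection \<open>Fractal surfaces\<close>

definition F_map ::
  "nat \<Rightarrow> (nat \<Rightarrow> real) \<Rightarrow> (nat \<Rightarrow> real) \<Rightarrow> (real \<times> real \<Rightarrow> real) \<Rightarrow> (real \<times> real \<Rightarrow> real)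
    \<Rightarrow> nat \<times> nat \<Rightarrow> real \<times> real \<times> real \<Rightarrow> real" where
  "F_map N x y S q w = (\<lambda>(a, b, c). S (L_map N x y w (a, b)) * c + q (L_map N x y w (a, b)))"

definition Psi_map ::
  "nat \<Rightarrow> (nat \<Rightarrow> real) \<Rightarrow> (nat \<Rightarrow> real) \<Rightarrow> (real \<times> real \<Rightarrow> real) \<Rightarrow> (real \<times> real \<Rightarrow> real)
    \<Rightarrow> nat \<times> nat \<Rightarrow> real \<times> real \<times> real \<Rightarrow> real \<times> real \<times> real" where
  "Psi_map N x y S q w =
     (\<lambda>(a, b, c). (edge_map N x (fst w) a, edge_map N y (snd w) b, F_map N x y S q w (a, b, c)))"

definition surface :: "(real \<times> real) set \<Rightarrow> (real \<times> real \<Rightarrow> real) \<Rightarrow> (real \<times> real \<times> real) set" where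
  "surface D f = {(a, b, f (a, b)) | a b. (a, b) \<in> D}"


subsection \<open>Words and vertical scaling matrices\<close>

definition L_word ::
  "nat \<Rightarrow> (nat \<Rightarrow> real) \<Rightarrow> (nat \<Rightarrow> real) \<Rightarrow> (nat \<times> nat) list \<Rightarrow> real \<times> real \<Rightarrow> real \<times> real" where
  "L_word N x y ws = foldr (\<circ>) (map (L_map N x y) ws) id"

definition D_word ::
  "nat \<Rightarrow> (nat \<Rightarrow> real) \<Rightarrow> (nat \<Rightarrow> real) \<Rightarrow> (nat \<times> nat) list \<Rightarrow> (real \<times> real) set" where
  "D_word N x y ws = L_word N x y ws ` dom_rect N x y"

definition s_bar ::
  "nat \<Rightarrow> (nat \<Rightarrow> real) \<Rightarrow> (nat \<Rightarrow> real) \<Rightarrow> (real \<times> real \<Rightarrow> real) \<Rightarrow> (nat \<times> nat) list \<Rightarrow> real" where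
  "s_bar N x y S ws = (SUP t\<in>D_word N x y ws. \<bar>S t\<bar>)"

text \<open>Matrices in the library are indexed by natural numbers, so the words of length \<open>n\<close> are
  listed, each exactly once. Another order would only conjugate the matrix below by a
  permutation matrix, which does not change its spectral radius.\<close>

definition words :: "nat \<Rightarrow> nat \<Rightarrow> (nat \<times> nat) list list" where
  "words N n = List.n_lists n (List.product [1..<Suc N] [1..<Suc N])"

lemma set_words: "set (words N n) = {ws. length ws = n \<and> set ws \<subseteq> letters N}"
  by (auto simp: words_def set_n_lists letters_def)

lemma distinct_words: "distinct (words N n)"
  unfolding words_def by (intro distinct_n_lists distinct_product distinct_upt)

definition M_bar ::
  "nat \<Rightarrow> (nat \<Rightarrow> real) \<Rightarrow> (nat \<Rightarrow> real) \<Rightarrow> (real \<times> real \<Rightarrow> real) \<Rightarrow> nat \<Rightarrow> complex Matrix.mat" where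
  "M_bar N x y S n =
     Matrix.mat (length (words N n)) (length (words N n))
       (\<lambda>(k, l). let i = words N n ! k; j = words N n ! l in
          if tl i = butlast j then complex_of_real (s_bar N x y S (i @ [last j])) else 0)"

text \<open>Only the matrices with \<open>n \<ge> 1\<close> are meaningful; the limit ignores the index 0.\<close>

definition rho_star ::
  "nat \<Rightarrow> (nat \<Rightarrow> real) \<Rightarrow> (nat \<Rightarrow> real) \<Rightarrow> (real \<times> real \<Rightarrow> real) \<Rightarrow> real" where
  "rho_star N x y S = lim (\<lambda>n. spectral_radius (M_bar N x y S n))"

end

theory Submission
  imports Defs "HOL-Real_Asymp.Real_Asymp"
begin

text \<open>
  The surface over a cell of level \<open>k\<close>, a square of side proportional to \<open>N\<^sup>-\<^sup>k\<close>, is covered by about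
  \<open>1 + N\<^sup>k osc\<close> cubes of that size, where \<open>osc\<close> is the oscillation of \<open>f\<close> on the cell. Hence the
  whole surface needs about \<open>N\<^sup>2\<^sup>k + N\<^sup>k O\<^sub>k\<close> cubes, \<open>O\<^sub>k\<close> being the sum of the oscillations over all
  cells of level \<open>k\<close>, and it is enough that \<open>O\<^sub>k\<close> grows at most like the \<open>k\<close>-th power of any
  number above \<open>max N rho_star\<close>.

  The functional equation \<open>f(L\<^sub>a t) = S(L\<^sub>a t) f(t) + q(L\<^sub>a t)\<close> and the Lipschitz conditions bound the
  oscillation on the cell of a word \<open>a # w\<close> by the supremum of \<open>|S|\<close> on this cell times the
  oscillation on the cell of \<open>w\<close>, plus an error of order \<open>N\<^sup>-\<^sup>k\<close> (\<open>osc_le\<close>). Fix \<open>n\<close>, enlarge the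
  supremum to the one over the cell of the first \<open>n + 1\<close> letters, and collect the oscillations by
  prefixes of length \<open>n\<close>. The resulting vectors satisfy \<open>V\<^sub>k\<^sub>+\<^sub>1 \<le> M V\<^sub>k + const * N\<^sup>k\<close> with the vertical
  scaling matrix \<open>M\<close> of level \<open>n\<close>, so they are \<open>O(r\<^sup>k)\<close> for each \<open>r \<ge> N\<close> above the spectral radius
  of \<open>M\<close> (\<open>sum_affine_recursion_le\<close>). Letting \<open>n\<close> tend to infinity gives the bound.

  The spectral radius is used only through comparison functions. If \<open>r\<close> exceeds it, a truncated
  Neumann series is a positive \<open>u\<close> with \<open>M u \<le> r (u - 1)\<close>
  (\<open>supersolution_of_spectral_radius_less\<close>); and a positive \<open>u\<close> with \<open>M u \<le> r u\<close> forces the spectral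
  radius to be at most \<open>r\<close> (\<open>spectral_radius_M_bar_le\<close>). The first kind of function absorbs the error
  terms of the recursion. A supersolution of level \<open>n\<close> produces a comparison function of level
  \<open>n + 1\<close>, so the spectral radii decrease in \<open>n\<close>, which is why the limit \<open>rho_star\<close> exists.
\<close>

section \<open>Transfer operators on functions of words\<close>

abbreviation word_set :: "'a set \<Rightarrow> nat \<Rightarrow> 'a list set" where
  "word_set A n \<equiv> {w. length w = n \<and> set w \<subseteq> A}"

lemma finite_word_set: "finite A \<Longrightarrow> finite (word_set A n)"
  using finite_lists_length_eq[of A n] by (simp add: conj_commute)

lemma card_word_set: "finite A \<Longrightarrow> card (word_set A n) = card A ^ n"
  using card_lists_length_eq[of A n] by (simp add: conj_commute)

lemma sum_word_set_Suc:
  "(\<Sum>w\<in>word_set A (Suc n). f w) = (\<Sum>a\<in>A. \<Sum>w\<in>word_set A n. f (a # w))"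
proof -
  have "(\<Sum>w\<in>word_set A (Suc n). f w) = (\<Sum>(a, w)\<in>A \<times> word_set A n. f (a # w))"
    by (rule sum.reindex_bij_witness[where i = "\<lambda>(a, w). a # w" and j = "\<lambda>w. (hd w, tl w)"])
      (auto simp: length_Suc_conv)
  then show ?thesis by (simp add: sum.cartesian_product)
qed

lemma sum_word_set_add:
  "(\<Sum>w\<in>word_set A (m + n). f w) = (\<Sum>v\<in>word_set A m. \<Sum>w\<in>word_set A n. f (v @ w))"
proof (induction m arbitrary: f)
  case 0
  have "word_set A 0 = {[]}" by auto
  then show ?case by simp
next
  case (Suc m)
  show ?case unfolding add_Suc sum_word_set_Suc by (simp add: Suc.IH)
qed

text \<open>For the weight \<open>s w = sup |S|\<close> over the cell of \<open>w\<close>, this operator on functions of words of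
  length \<open>n\<close> is the vertical scaling matrix of level \<open>n\<close>. Working with functions of words instead
  of vectors lets two consecutive levels be compared without any index bookkeeping.\<close>

definition transfer :: "'a set \<Rightarrow> ('a list \<Rightarrow> real) \<Rightarrow> ('a list \<Rightarrow> real) \<Rightarrow> 'a list \<Rightarrow> real" where
  "transfer A s u w = (\<Sum>a\<in>A. s (w @ [a]) * u (tl w @ [a]))"

lemma shift_word:
  assumes "w \<in> word_set A n" "n \<ge> 1" "a \<in> A"
  shows "tl w @ [a] \<in> word_set A n"
  using assms by (cases w) auto

text \<open>The inequality is that of the Neumann series \<open>u = 1 + T 1 / r + T\<^sup>2 1 / r\<^sup>2 + \<dots>\<close>, for which
  \<open>T u = r (u - 1)\<close>. The gain \<open>- r\<close> over a plain inequality \<open>T u \<le> r u\<close> is what absorbs the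
  inhomogeneous terms below.\<close>

definition supersolution ::
    "'a set \<Rightarrow> ('a list \<Rightarrow> real) \<Rightarrow> nat \<Rightarrow> real \<Rightarrow> ('a list \<Rightarrow> real) \<Rightarrow> bool" where
  "supersolution A s n r u \<longleftrightarrow>
     (\<forall>w\<in>word_set A n. 1 \<le> u w \<and> transfer A s u w \<le> r * (u w - 1))"

locale word_weight =
  fixes A :: "'a set" and s :: "'a list \<Rightarrow> real"
  assumes finite_alphabet: "finite A"
    and weight_nonneg: "set w \<subseteq> A \<Longrightarrow> 0 \<le> s w"
    and weight_append_letter: "set w \<subseteq> A \<Longrightarrow> a \<in> A \<Longrightarrow> s (w @ [a]) \<le> s w"
begin

lemma weight_append:
  "set w \<subseteq> A \<Longrightarrow> set v \<subseteq> A \<Longrightarrow> s (w @ v) \<le> s w"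
proof (induction v rule: rev_induct)
  case (snoc a v)
  have "s ((w @ v) @ [a]) \<le> s (w @ v)"
    using snoc.prems by (intro weight_append_letter) auto
  with snoc show ?case by simp
qed simp

lemma transfer_mono:
  assumes "w \<in> word_set A n" "n \<ge> 1" "\<And>v. v \<in> word_set A n \<Longrightarrow> u v \<le> u' v"
  shows "transfer A s u w \<le> transfer A s u' w"
  unfolding transfer_def
  using assms shift_word[OF assms(1,2)]
  by (intro sum_mono mult_left_mono assms(3) weight_nonneg) auto

text \<open>This carries an upper bound for the growth rate from one level to the next. With
  \<open>u' w = s w * u (tl w)\<close>, replacing \<open>s (w @ [a])\<close> by the larger \<open>s w\<close> turns the operator of level
  \<open>Suc n\<close> applied to \<open>u'\<close> into \<open>s w\<close> times that of level \<open>n\<close> applied to \<open>u\<close> at \<open>tl w\<close>. Where \<open>s\<close>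
  vanishes this \<open>u'\<close> is not positive, so a small constant is added; the slack \<open>- r\<close> pays for it.\<close>

lemma supersolution_longer_words:
  assumes u: "supersolution A s n r u" and n: "n \<ge> 1" and r: "r > 0"
  obtains u' where "\<forall>w\<in>word_set A (Suc n). 0 < u' w \<and> transfer A s u' w \<le> r * u' w"
proof (rule that, rule ballI)
  define \<eta> where "\<eta> = r / (real (card A) + 1)"
  have \<eta>: "\<eta> > 0" "card A * \<eta> \<le> r"
    using r by (auto simp: \<eta>_def field_simps)
  define u' where "u' w = s w * u (tl w) + \<eta>" for w
  fix w assume w: "w \<in> word_set A (Suc n)"
  then have tl: "tl w \<in> word_set A n" by (cases w) auto
  have tl_w: "tl w \<noteq> []" using tl n by (cases "tl w") auto
  have sw: "0 \<le> s w" using w by (intro weight_nonneg) simp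
  have u_tl: "1 \<le> u (tl w)" "transfer A s u (tl w) \<le> r * (u (tl w) - 1)"
    using u tl unfolding supersolution_def by auto
  have "transfer A s u' w
      \<le> (\<Sum>a\<in>A. s w * (s (tl w @ [a]) * u (tl (tl w) @ [a]) + \<eta>))"
    unfolding transfer_def
  proof (rule sum_mono)
    fix a assume a: "a \<in> A"
    have "tl (tl w) @ [a] \<in> word_set A n" by (rule shift_word[OF tl n a])
    then have "1 \<le> u (tl (tl w) @ [a])" using u unfolding supersolution_def by auto
    moreover have "0 \<le> s (tl w @ [a])" using tl a by (intro weight_nonneg) auto
    ultimately have "0 \<le> u' (tl w @ [a])"
      using \<eta>(1) tl_w by (simp add: u'_def)
    then have "s (w @ [a]) * u' (tl w @ [a]) \<le> s w * u' (tl w @ [a])"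
      using w a by (intro mult_right_mono weight_append_letter) auto
    then show "s (w @ [a]) * u' (tl w @ [a])
        \<le> s w * (s (tl w @ [a]) * u (tl (tl w) @ [a]) + \<eta>)"
      using tl_w by (simp add: u'_def)
  qed
  also have "\<dots> = s w * (transfer A s u (tl w) + card A * \<eta>)"
    by (simp add: transfer_def sum_distrib_left[symmetric] sum.distrib)
  also have "\<dots> \<le> s w * (r * u (tl w))"
    using u_tl \<eta> by (intro mult_left_mono sw) (auto simp: algebra_simps)
  also have "\<dots> \<le> r * u' w"
    using r \<eta> by (simp add: u'_def algebra_simps)
  finally show "0 < u' w \<and> transfer A s u' w \<le> r * u' w"
    using u_tl sw \<eta> by (auto simp: u'_def intro!: add_nonneg_pos)
qed

text \<open>Sum \<open>b\<close> over all words of length \<open>n + k\<close> with a given prefix \<open>v\<close> of length \<open>n\<close>. Since the weight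
  decreases along prefixes, \<open>s\<close> of the long word may be replaced by \<open>s\<close> of its first \<open>n + 1\<close>
  letters, so these sums satisfy \<open>V\<^sub>k\<^sub>+\<^sub>1 \<le> T V\<^sub>k + const * N\<^sup>k\<close>: there are \<open>N\<^sup>2 * N\<^sup>2\<^sup>k\<close>
  continuations, each with error at most \<open>c / N\<^sup>k\<close>. Induction on \<open>k\<close> then gives \<open>V\<^sub>k \<le> B * r\<^sup>k * u\<close>.\<close>

lemma sum_affine_recursion_le:
  fixes b :: "'a list \<Rightarrow> real" and N :: nat and r c :: real
  assumes u: "supersolution A s n r u" and n: "n \<ge> 1"
    and card_A: "card A = N ^ 2" and N: "N \<ge> 1" and r: "r \<ge> N"
    and b_nonneg: "\<And>w. set w \<subseteq> A \<Longrightarrow> 0 \<le> b w"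
    and b_Cons: "\<And>a w. a \<in> A \<Longrightarrow> set w \<subseteq> A \<Longrightarrow> b (a # w) \<le> s (a # w) * b w + c / N ^ length w"
    and c: "c \<ge> 0"
  obtains B where "B \<ge> 0" "\<forall>k. (\<Sum>w\<in>word_set A (n + k). b w) \<le> B * r ^ k"
proof -
  have r0: "r > 0" using r N by linarith
  define V where "V k v = (\<Sum>w\<in>word_set A k. b (v @ w))" for k v
  \<comment> \<open>The first term starts the induction; the second makes \<open>B * r\<close> dominate the error constant.\<close>
  define B where "B = Max (insert 0 (b ` word_set A n)) + c * N ^ 2 / r"
  have fin: "finite (word_set A m)" for m by (rule finite_word_set[OF finite_alphabet])
  have B: "b v \<le> B" if "v \<in> word_set A n" for v
  proof -
    have "b v \<le> Max (insert 0 (b ` word_set A n))"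
      using that fin by (intro Max_ge) auto
    moreover have "0 \<le> c * N ^ 2 / r" using c r0 by simp
    ultimately show ?thesis by (simp add: B_def)
  qed
  have "0 \<le> Max (insert 0 (b ` word_set A n))" using fin by (intro Max_ge) auto
  then have B': "c * N ^ 2 \<le> B * r" and B0: "B \<ge> 0"
    using r0 c by (auto simp: B_def field_simps)
  have V_Suc: "V (Suc k) v \<le> transfer A s (V k) v + c * N ^ 2 * r ^ k"
    if v: "v \<in> word_set A n" for k v
  proof -
    have "V (Suc k) v = (\<Sum>a\<in>A. \<Sum>w\<in>word_set A k. b (v @ a # w))"
      by (simp add: V_def sum_word_set_Suc)
    also have "\<dots> \<le> (\<Sum>a\<in>A. \<Sum>w\<in>word_set A k.
        s (v @ [a]) * b ((tl v @ [a]) @ w) + c / N ^ k)"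
    proof (intro sum_mono)
      fix a w assume a: "a \<in> A" and w: "w \<in> word_set A k"
      have v': "v = hd v # tl v" "set v \<subseteq> A" using v n by (cases v; auto)+
      have hd_tl: "hd v \<in> A" "set (tl v) \<subseteq> A" using v' by (metis list.set_intros(1) subsetD, metis set_subset_Cons order_trans)
      have len: "length (tl v @ a # w) = n + k" using v w n by simp
      have *: "hd v # tl v @ a # w = (v @ [a]) @ w"
        using v'(1) by (metis append_Cons append_Nil append_assoc)
      have "b (v @ a # w) = b (hd v # (tl v @ a # w))" using v'(1) by (metis append_Cons)
      also have "\<dots> \<le> s (hd v # tl v @ a # w) * b (tl v @ a # w) + c / N ^ (n + k)"
        using b_Cons[of "hd v" "tl v @ a # w"] hd_tl a w unfolding len by auto
      also have "s (hd v # tl v @ a # w) * b (tl v @ a # w) \<le> s (v @ [a]) * b (tl v @ a # w)"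
        unfolding * using v' hd_tl a w by (intro mult_right_mono b_nonneg weight_append) auto
      also have "c / N ^ (n + k) \<le> c / N ^ k"
        using c N by (intro divide_left_mono) (auto intro!: power_increasing mult_pos_pos)
      finally show "b (v @ a # w) \<le> s (v @ [a]) * b ((tl v @ [a]) @ w) + c / N ^ k" by simp
    qed
    also have "\<dots> = transfer A s (V k) v + card A * (card (word_set A k) * (c / N ^ k))"
      by (simp add: transfer_def V_def sum.distrib sum_distrib_left)
    also have "card A * (card (word_set A k) * (c / N ^ k)) = c * N ^ 2 * N ^ k"
      using N by (simp add: card_word_set finite_alphabet card_A power_mult[symmetric] mult_2 power_add)
    also have "\<dots> \<le> c * N ^ 2 * r ^ k"
      using c r by (auto intro!: mult_left_mono power_mono)
    finally show ?thesis by simp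
  qed
  have V: "V k v \<le> B * r ^ k * u v" if "v \<in> word_set A n" for k v
    using that
  proof (induction k arbitrary: v)
    case 0
    have "word_set A 0 = {[]}" by auto
    then have "V 0 v = b v" by (simp add: V_def)
    also have "\<dots> \<le> B * 1" using B[OF 0] by simp
    also have "\<dots> \<le> B * u v" using 0 u B0 by (intro mult_left_mono) (auto simp: supersolution_def)
    finally show ?case by simp
  next
    case (Suc k)
    have "transfer A s (V k) v \<le> transfer A s (\<lambda>v. B * r ^ k * u v) v"
      using Suc.IH by (rule transfer_mono[OF Suc.prems n])
    also have "\<dots> = B * r ^ k * transfer A s u v"
      by (simp add: transfer_def sum_distrib_left algebra_simps)
    also have "\<dots> \<le> B * r ^ k * (r * (u v - 1))"
      using Suc.prems u B0 r0 by (intro mult_left_mono) (auto simp: supersolution_def)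
    finally have "V (Suc k) v \<le> B * r ^ k * (r * (u v - 1)) + c * N ^ 2 * r ^ k"
      using V_Suc[OF Suc.prems, of k] by linarith
    also have "\<dots> \<le> B * r ^ k * (r * (u v - 1)) + B * r * r ^ k"
      using B' r0 by (intro add_left_mono mult_right_mono) auto
    also have "\<dots> = B * r ^ Suc k * u v" by (simp add: algebra_simps)
    finally show ?case .
  qed
  show ?thesis
  proof (intro that allI)
    show "0 \<le> B * (\<Sum>v\<in>word_set A n. u v)"
      using B0 u by (intro mult_nonneg_nonneg sum_nonneg) (auto simp: supersolution_def intro: order_trans[OF zero_le_one])
    fix k
    have "(\<Sum>w\<in>word_set A (n + k). b w) = (\<Sum>v\<in>word_set A n. V k v)"
      by (simp add: sum_word_set_add V_def)
    also have "\<dots> \<le> (\<Sum>v\<in>word_set A n. B * r ^ k * u v)" by (intro sum_mono V)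
    also have "\<dots> = B * (\<Sum>v\<in>word_set A n. u v) * r ^ k"
      by (simp add: sum_distrib_left sum_distrib_right algebra_simps)
    finally show "(\<Sum>w\<in>word_set A (n + k). b w) \<le> B * (\<Sum>v\<in>word_set A n. u v) * r ^ k" .
  qed
qed

end

section \<open>Spectral radii of the vertical scaling matrices\<close>

lemma smult_mat_mult_vec:
  fixes c :: complex
  assumes "M \<in> carrier_mat m d" "v \<in> carrier_vec d"
  shows "(c \<cdot>\<^sub>m M) *\<^sub>v v = c \<cdot>\<^sub>v (M *\<^sub>v v)"
  using assms by (intro eq_vecI) (auto simp: scalar_prod_def sum_distrib_left mult.assoc)


text \<open>Dividing by \<open>r\<close> scales every eigenvalue, so the rescaled matrix has spectral radius below \<open>1\<close>,
  and its powers are bounded by the Jordan normal form.\<close>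

lemma bounded_mat_pow_of_spectral_radius_less:
  fixes M :: "complex mat"
  assumes M: "M \<in> carrier_mat d d" and r: "spectral_radius M < r" "r > 0"
  obtains c where "\<And>m i j. i < d \<Longrightarrow> j < d \<Longrightarrow> cmod (((complex_of_real (1 / r) \<cdot>\<^sub>m M) ^\<^sub>m m) $$ (i, j)) \<le> c"
proof (cases "d = 0")
  case True
  then show ?thesis using that by simp
next
  case False
  let ?B = "complex_of_real (1 / r) \<cdot>\<^sub>m M"
  have B: "?B \<in> carrier_mat d d" using M by simp
  obtain l where l: "l \<in> spectrum ?B" "spectral_radius ?B = cmod l"
    using spectral_radius_mem_max(1)[OF B] False by auto
  then obtain v where v: "v \<in> carrier_vec d" "v \<noteq> 0\<^sub>v d" "?B *\<^sub>v v = l \<cdot>\<^sub>v v"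
    using B unfolding spectrum_def eigenvalue_def eigenvector_def by auto
  have M_eq: "M = complex_of_real r \<cdot>\<^sub>m ?B"
    using r by (intro eq_matI) (auto simp: mult.assoc[symmetric])
  have "M *\<^sub>v v = complex_of_real r \<cdot>\<^sub>v (?B *\<^sub>v v)"
    using arg_cong[OF M_eq, of "\<lambda>X. X *\<^sub>v v"] smult_mat_mult_vec[OF B v(1)] by (rule trans)
  also have "\<dots> = (complex_of_real r * l) \<cdot>\<^sub>v v"
    unfolding v(3) by (simp add: smult_smult_assoc)
  finally have "complex_of_real r * l \<in> spectrum M"
    using v M unfolding spectrum_def eigenvalue_def eigenvector_def by auto
  then have "cmod (complex_of_real r * l) \<le> spectral_radius M"
    using spectral_radius_mem_max(2)[OF M] False by blast
  then have "r * cmod l \<le> spectral_radius M" using r by (simp add: norm_mult)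
  then have "r * cmod l < r * 1" using r(1) by linarith
  then have "spectral_radius ?B < 1" using r l by simp
  from spectral_radius_jnf_norm_bound_less_1_upper_triangular[OF B this]
  obtain c where c: "\<And>k. norm_bound (?B ^\<^sub>m k) c" by blast
  have entry: "cmod (X $$ (i, j)) \<le> c"
    if "norm_bound X c" "X \<in> carrier_mat d d" "i < d" "j < d" for X :: "complex mat" and i j
    using that by (auto simp: norm_bound_def)
  show ?thesis using entry[OF c pow_carrier_mat[OF B]] by (rule that)
qed

lemma spectral_radius_nonneg:
  assumes "M \<in> carrier_mat d d" "d > 0"
  shows "0 \<le> spectral_radius M"
  using spectral_radius_mem_max(1)[OF assms] by auto

lemma M_bar_carrier: "M_bar N x y S n \<in> carrier_mat (length (words N n)) (length (words N n))"
  by (simp add: M_bar_def)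

lemma words_nth_mem: "k < length (words N n) \<Longrightarrow> words N n ! k \<in> word_set (letters N) n"
  using nth_mem[of k "words N n"] by (simp add: set_words)

lemma word_index:
  assumes "w \<in> word_set (letters N) n"
  obtains k where "k < length (words N n)" "words N n ! k = w"
  using assms set_words[of N n] by (metis (mono_tags, lifting) in_set_conv_nth)

lemma length_words_pos:
  assumes "N \<ge> 1"
  shows "length (words N n) > 0"
proof -
  have "set (replicate n (1, 1)) \<subseteq> letters N" using assms by (auto simp: letters_def)
  then have "replicate n (1, 1) \<in> set (words N n)" unfolding set_words by simp
  then show ?thesis by (rule length_pos_if_in_set)
qed

text \<open>Each row of the matrix is supported on the shifted words \<open>tl w @ [a]\<close>, and so the matrix acts as
  the transfer operator.\<close>

lemma M_bar_mult_vec: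
  assumes n: "n \<ge> 1" and k: "k < length (words N n)"
  shows "(M_bar N x y S n *\<^sub>v vec (length (words N n)) (\<lambda>l. u (words N n ! l))) $ k
    = (\<Sum>a\<in>letters N. complex_of_real (s_bar N x y S (words N n ! k @ [a])) * u (tl (words N n ! k) @ [a]))"
proof -
  let ?W = "words N n" and ?s = "s_bar N x y S"
  let ?w = "?W ! k"
  let ?t = "\<lambda>v. if tl ?w = butlast v then complex_of_real (?s (?w @ [last v])) * u v else 0"
  have w: "?w \<in> word_set (letters N) n" using k by (rule words_nth_mem)
  have "(M_bar N x y S n *\<^sub>v vec (length ?W) (\<lambda>l. u (?W ! l))) $ k
      = (\<Sum>l<length ?W. ?t (?W ! l))"
    using k by (auto simp: M_bar_def scalar_prod_def Let_def lessThan_atLeast0 intro!: sum.cong)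
  also have "\<dots> = (\<Sum>v\<in>set ?W. ?t v)"
    by (subst sum.reindex_bij_betw[OF bij_betw_nth[OF distinct_words refl refl], symmetric]) simp
  also have "\<dots> = (\<Sum>v\<in>(\<lambda>a. tl ?w @ [a]) ` letters N. ?t v)"
  proof (rule sum.mono_neutral_right)
    show "(\<lambda>a. tl ?w @ [a]) ` letters N \<subseteq> set ?W"
      using shift_word[OF w n] unfolding set_words by blast
    show "\<forall>v\<in>set ?W - (\<lambda>a. tl ?w @ [a]) ` letters N. ?t v = 0"
    proof
      fix v assume v: "v \<in> set ?W - (\<lambda>a. tl ?w @ [a]) ` letters N"
      then have "v \<noteq> []" "set v \<subseteq> letters N" using n by (auto simp: set_words)
      then have "v = butlast v @ [last v]" "last v \<in> letters N" by auto
      then show "?t v = 0" using v by auto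
    qed
  qed simp
  also have "\<dots> = (\<Sum>a\<in>letters N. ?t (tl ?w @ [a]))"
    by (subst sum.reindex) (auto simp: inj_on_def)
  finally show ?thesis by simp
qed

text \<open>Every \<open>r\<close> above the spectral radius admits a supersolution: for \<open>r'\<close> strictly in between, the
  iterates \<open>T\<^sup>k 1\<close> are \<open>O(r'\<^sup>k)\<close>, so \<open>T\<^sup>m 1 / r\<^sup>m\<close> becomes small and twice a partial sum of the
  Neumann series satisfies the inequality.\<close>

lemma supersolution_of_spectral_radius_less:
  assumes weight: "word_weight (letters N) (s_bar N x y S)"
    and n: "n \<ge> 1" and r: "spectral_radius (M_bar N x y S n) < r" and r0: "r > 0"
  obtains u where "supersolution (letters N) (s_bar N x y S) n r u"
proof -
  let ?d = "length (words N n)" and ?M = "M_bar N x y S n"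
  let ?T = "transfer (letters N) (s_bar N x y S)"
  obtain r' where r': "spectral_radius ?M < r'" "0 < r'" "r' < r"
    using dense[of "max 0 (spectral_radius ?M)" r] r r0 by auto
  let ?B = "complex_of_real (1 / r') \<cdot>\<^sub>m ?M"
  have B: "?B \<in> carrier_mat ?d ?d" using M_bar_carrier by simp
  obtain c where c: "\<And>m i j. i < ?d \<Longrightarrow> j < ?d \<Longrightarrow> cmod ((?B ^\<^sub>m m) $$ (i, j)) \<le> c"
    using bounded_mat_pow_of_spectral_radius_less[OF M_bar_carrier r'(1,2)] by blast
  have step: "?B *\<^sub>v vec ?d (\<lambda>l. complex_of_real (u (words N n ! l)))
      = vec ?d (\<lambda>l. complex_of_real (?T u (words N n ! l) / r'))" for u
  proof (rule eq_vecI)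
    fix k assume "k < dim_vec (vec ?d (\<lambda>l. complex_of_real (?T u (words N n ! l) / r')))"
    then have k: "k < ?d" by simp
    have "(?B *\<^sub>v vec ?d (\<lambda>l. complex_of_real (u (words N n ! l)))) $ k
        = complex_of_real (1 / r') * (?M *\<^sub>v vec ?d (\<lambda>l. complex_of_real (u (words N n ! l)))) $ k"
      using k M_bar_carrier[of N x y S n] by (subst smult_mat_mult_vec) auto
    then show "(?B *\<^sub>v vec ?d (\<lambda>l. complex_of_real (u (words N n ! l)))) $ k
        = vec ?d (\<lambda>l. complex_of_real (?T u (words N n ! l) / r')) $ k"
      unfolding M_bar_mult_vec[OF n k, of x y S "\<lambda>v. complex_of_real (u v)"] using k by (simp add: transfer_def)
  qed (use B in auto)
  have pow: "(?B ^\<^sub>m m) *\<^sub>v vec ?d (\<lambda>l. complex_of_real (u (words N n ! l)))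
      = vec ?d (\<lambda>l. complex_of_real ((?T ^^ m) u (words N n ! l) / r' ^ m))" for m u
  proof (induction m arbitrary: u)
    case 0
    then show ?case using M_bar_carrier[of N x y S n] by simp
  next
    case (Suc m)
    have "?T (\<lambda>v. u v / r') = (\<lambda>v. ?T u v / r')" for u
      by (auto simp: transfer_def sum_divide_distrib)
    then have lin: "(?T ^^ m) (\<lambda>v. u v / r') = (\<lambda>v. (?T ^^ m) u v / r')" for u
      by (induction m arbitrary: u) (simp_all add: funpow_Suc_right del: funpow.simps)
    have "(?B ^\<^sub>m Suc m) *\<^sub>v vec ?d (\<lambda>l. complex_of_real (u (words N n ! l)))
        = (?B ^\<^sub>m m) *\<^sub>v (?B *\<^sub>v vec ?d (\<lambda>l. complex_of_real (u (words N n ! l))))"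
      unfolding pow_mat.simps by (rule assoc_mult_mat_vec[OF pow_carrier_mat[OF B] B]) simp
    also have "\<dots> = vec ?d (\<lambda>l. complex_of_real ((?T ^^ m) (\<lambda>v. ?T u v / r') (words N n ! l) / r' ^ m))"
      unfolding step by (rule Suc.IH)
    finally show ?case
      unfolding lin by (simp add: funpow_Suc_right mult.commute del: funpow.simps)
  qed
  let ?P = "\<lambda>m v. (?T ^^ m) (\<lambda>_. 1) v"
  have P_le: "?P m w \<le> ?d * c * r' ^ m" if w: "w \<in> word_set (letters N) n" for m w
  proof -
    obtain k where k: "k < ?d" "words N n ! k = w" using word_index[OF w] by blast
    have Bm: "?B ^\<^sub>m m \<in> carrier_mat ?d ?d" using B by (rule pow_carrier_mat)
    have "complex_of_real (?P m w / r' ^ m)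
        = vec ?d (\<lambda>l. complex_of_real (?P m (words N n ! l) / r' ^ m)) $ k"
      using k by simp
    also have "\<dots> = ((?B ^\<^sub>m m) *\<^sub>v vec ?d (\<lambda>l. complex_of_real 1)) $ k"
      unfolding pow[of m "\<lambda>_. 1"] ..
    also have "\<dots> = (\<Sum>j<?d. (?B ^\<^sub>m m) $$ (k, j))"
      using k(1) carrier_matD[OF Bm] by (simp add: scalar_prod_def lessThan_atLeast0 del: of_real_divide pow_mat_dim)
    finally have "complex_of_real (?P m w / r' ^ m) = (\<Sum>j<?d. (?B ^\<^sub>m m) $$ (k, j))" .
    then have "\<bar>?P m w / r' ^ m\<bar> = cmod (\<Sum>j<?d. (?B ^\<^sub>m m) $$ (k, j))"
      by (metis norm_of_real)
    also have "\<dots> \<le> (\<Sum>j<?d. c)" using c k by (intro sum_norm_le) auto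
    finally have "\<bar>?P m w / r' ^ m\<bar> \<le> ?d * c" by simp
    then have "?P m w / r' ^ m \<le> ?d * c" by (rule abs_le_D1)
    then show ?thesis using r' by (simp add: field_simps)
  qed
  have "(\<lambda>m. ?d * c * (r' / r) ^ m) \<longlonglongrightarrow> ?d * c * 0"
    using r' by (intro tendsto_intros LIMSEQ_realpow_zero) auto
  then have "\<forall>\<^sub>F m in sequentially. ?d * c * (r' / r) ^ m < 1 / 2"
    by (intro order_tendstoD) auto
  then obtain m0 where "\<And>m. m \<ge> m0 \<Longrightarrow> ?d * c * (r' / r) ^ m < 1 / 2"
    unfolding eventually_sequentially by blast
  then obtain m where m: "?d * c * (r' / r) ^ Suc m < 1 / 2"
    by (meson le_SucI order_refl)
  \<comment> \<open>Truncating the series leaves the remainder \<open>T\<^sup>m\<^sup>+\<^sup>1 1 / r\<^sup>m\<^sup>+\<^sup>1 < 1 / 2\<close>; the factor \<open>2\<close> turns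
    the remaining slack \<open>1 / 2\<close> into \<open>1\<close>.\<close>
  define u where "u w = 2 * (\<Sum>k<Suc m. ?P k w / r ^ k)" for w
  have P_nonneg: "0 \<le> ?P k w" if "w \<in> word_set (letters N) n" for k w
    using that
  proof (induction k arbitrary: w)
    case (Suc k)
    have "0 \<le> s_bar N x y S (w @ [a]) * ?P k (tl w @ [a])" if "a \<in> letters N" for a
      using Suc.prems that shift_word[OF Suc.prems n that]
      by (intro mult_nonneg_nonneg Suc.IH word_weight.weight_nonneg[OF weight]) auto
    then have "0 \<le> ?T (?P k) w"
      unfolding transfer_def by (intro sum_nonneg)
    then show ?case by simp
  qed simp
  have "supersolution (letters N) (s_bar N x y S) n r u"
    unfolding supersolution_def
  proof (intro ballI conjI)
    fix w assume w: "w \<in> word_set (letters N) n"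
    have shift: "(\<Sum>k<Suc m. f k) = f 0 + (\<Sum>k<m. f (Suc k))" for f :: "nat \<Rightarrow> real"
      by (rule sum.lessThan_Suc_shift)
    have "0 \<le> (\<Sum>k<m. ?P (Suc k) w / r ^ Suc k)"
      using P_nonneg[OF w] r0 by (intro sum_nonneg divide_nonneg_nonneg) (auto simp del: funpow.simps)
    then show "1 \<le> u w" unfolding u_def shift by simp
    have "?T u w = 2 * (\<Sum>k<Suc m. ?T (?P k) w / r ^ k)"
      unfolding u_def transfer_def sum_distrib_left sum_distrib_right sum_divide_distrib
      by (subst sum.swap) (simp add: algebra_simps)
    also have "\<dots> = r * (2 * (\<Sum>k<Suc m. ?P (Suc k) w / r ^ Suc k))"
      unfolding sum_distrib_left using r0 by (intro sum.cong) auto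
    also have "(\<Sum>k<Suc m. ?P (Suc k) w / r ^ Suc k)
        = (\<Sum>k<Suc m. ?P k w / r ^ k) + ?P (Suc m) w / r ^ Suc m - 1"
      using sum.lessThan_Suc_shift[of "\<lambda>k. ?P k w / r ^ k" "Suc m"] by simp
    also have "?P (Suc m) w / r ^ Suc m \<le> ?d * c * (r' / r) ^ Suc m"
      using P_le[OF w, of "Suc m"] r0 by (simp add: power_divide divide_right_mono del: power_Suc funpow.simps)
    also have "\<dots> < 1 / 2" by (rule m)
    finally show "?T u w \<le> r * (u w - 1)"
      using r0 unfolding u_def[of w] by (simp add: algebra_simps del: sum.lessThan_Suc)
  qed
  then show ?thesis by (rule that)
qed

text \<open>Conversely, a positive \<open>u\<close> with \<open>T u \<le> r u\<close> bounds the modulus of every eigenvalue by \<open>r\<close>: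
  compare the eigenvector with \<open>u\<close> at a word where the ratio of its modulus to \<open>u\<close> is largest.\<close>

lemma spectral_radius_M_bar_le:
  assumes weight: "word_weight (letters N) (s_bar N x y S)"
    and N: "N \<ge> 1" and n: "n \<ge> 1"
    and u: "\<And>w. w \<in> word_set (letters N) n \<Longrightarrow>
      0 < u w \<and> transfer (letters N) (s_bar N x y S) u w \<le> r * u w"
  shows "spectral_radius (M_bar N x y S n) \<le> r"
proof -
  let ?d = "length (words N n)" and ?W = "words N n"
  obtain l v where l: "spectral_radius (M_bar N x y S n) = cmod l"
    and v: "v \<in> carrier_vec ?d" "v \<noteq> 0\<^sub>v ?d" "M_bar N x y S n *\<^sub>v v = l \<cdot>\<^sub>v v"
    using spectral_radius_mem_max(1)[OF M_bar_carrier length_words_pos[OF N, of n], of x y S]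
      M_bar_carrier[of N x y S n]
    unfolding spectrum_def eigenvalue_def eigenvector_def by auto
  \<comment> \<open>\<open>e\<close> is the eigenvector as a function of words, \<open>t\<close> its maximal ratio to \<open>u\<close>.\<close>
  define idx where "idx w = (SOME k. k < ?d \<and> ?W ! k = w)" for w
  have idx: "idx (?W ! k) = k" if "k < ?d" for k
  proof -
    have "idx (?W ! k) < ?d \<and> ?W ! idx (?W ! k) = ?W ! k"
      unfolding idx_def by (rule someI[of _ k]) (use that in simp)
    then show ?thesis using that distinct_words nth_eq_iff_index_eq by blast
  qed
  define e where "e w = v $ idx w" for w
  have v_eq: "v = vec ?d (\<lambda>k. e (?W ! k))"
    using v(1) by (intro eq_vecI) (auto simp: e_def idx)
  define t where "t = Max ((\<lambda>w. cmod (e w) / u w) ` set ?W)"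
  have ne: "set ?W \<noteq> {}" using length_words_pos[OF N, of n] by auto
  have u_pos: "0 < u w" if "w \<in> set ?W" for w using u that set_words by auto
  have e_le: "cmod (e w) \<le> t * u w" if "w \<in> set ?W" for w
  proof -
    have "cmod (e w) / u w \<le> t" unfolding t_def using that by (intro Max_ge) auto
    then show ?thesis using u_pos[OF that] by (simp add: field_simps)
  qed
  have "t \<in> (\<lambda>w. cmod (e w) / u w) ` set ?W"
    unfolding t_def using ne by (intro Max_in) auto
  then obtain w where w: "w \<in> set ?W" "t = cmod (e w) / u w" by blast
  then have e_w: "cmod (e w) = t * u w" using u_pos[of w] by simp
  obtain k where k: "k < ?d" "?W ! k = w" using w(1) by (auto simp: in_set_conv_nth)
  have "t > 0"
  proof (rule ccontr)
    assume "\<not> t > 0"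
    then have "e w = 0" if "w \<in> set ?W" for w
      using e_le[OF that] u_pos[OF that] by (metis mult_nonpos_nonneg not_less norm_le_zero_iff order_less_imp_le order_trans)
    then have "v = 0\<^sub>v ?d" by (subst v_eq) (auto intro!: eq_vecI)
    then show False using v by simp
  qed
  have w': "w \<in> word_set (letters N) n" using w(1) by (simp add: set_words)
  have "l * e w = (l \<cdot>\<^sub>v v) $ k" using k v(1) by (simp add: e_def idx flip: k(2))
  also have "\<dots> = (\<Sum>a\<in>letters N. complex_of_real (s_bar N x y S (w @ [a])) * e (tl w @ [a]))"
    unfolding v(3)[symmetric] by (subst v_eq, subst M_bar_mult_vec[OF n k(1)]) (simp only: k(2))
  finally have "cmod l * (t * u w)
      = cmod (\<Sum>a\<in>letters N. complex_of_real (s_bar N x y S (w @ [a])) * e (tl w @ [a]))"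
    using e_w by (metis norm_mult)
  also have "\<dots> \<le> (\<Sum>a\<in>letters N. s_bar N x y S (w @ [a]) * (t * u (tl w @ [a])))"
  proof (rule sum_norm_le)
    fix a assume a: "a \<in> letters N"
    have "0 \<le> s_bar N x y S (w @ [a])"
      using w' a by (intro word_weight.weight_nonneg[OF weight]) auto
    moreover have "tl w @ [a] \<in> set ?W" using shift_word[OF w' n a] unfolding set_words .
    ultimately show "cmod (complex_of_real (s_bar N x y S (w @ [a])) * e (tl w @ [a]))
        \<le> s_bar N x y S (w @ [a]) * (t * u (tl w @ [a]))"
      by (auto simp: norm_mult intro!: mult_left_mono e_le)
  qed
  also have "\<dots> = t * transfer (letters N) (s_bar N x y S) u w"
    by (simp add: transfer_def sum_distrib_left algebra_simps)
  also have "\<dots> \<le> t * (r * u w)" using u[OF w'] \<open>t > 0\<close> by (intro mult_left_mono) auto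
  finally have "cmod l * (t * u w) \<le> r * (t * u w)" by (simp add: algebra_simps)
  moreover have "t * u w > 0" using \<open>t > 0\<close> u_pos[OF w(1)] by simp
  ultimately have "cmod l \<le> r" by (rule mult_right_le_imp_le)
  then show ?thesis using l by simp
qed

lemma spectral_radius_M_bar_Suc_le:
  assumes weight: "word_weight (letters N) (s_bar N x y S)" and N: "N \<ge> 1" and n: "n \<ge> 1"
  shows "spectral_radius (M_bar N x y S (Suc n)) \<le> spectral_radius (M_bar N x y S n)"
proof (rule dense_ge)
  fix r assume r: "spectral_radius (M_bar N x y S n) < r"
  have r0: "r > 0"
    using spectral_radius_nonneg[OF M_bar_carrier length_words_pos[OF N]] r by (rule le_less_trans)
  obtain u where u: "supersolution (letters N) (s_bar N x y S) n r u"
    using supersolution_of_spectral_radius_less[OF weight n r r0] .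
  obtain u' where u': "\<forall>w\<in>word_set (letters N) (Suc n).
      0 < u' w \<and> transfer (letters N) (s_bar N x y S) u' w \<le> r * u' w"
    using word_weight.supersolution_longer_words[OF weight u n r0] .
  show "spectral_radius (M_bar N x y S (Suc n)) \<le> r"
  proof (rule spectral_radius_M_bar_le[OF weight N, where u = u'])
    fix w assume "w \<in> word_set (letters N) (Suc n)"
    then show "0 < u' w \<and> transfer (letters N) (s_bar N x y S) u' w \<le> r * u' w" by (rule bspec[OF u'])
  qed simp
qed

text \<open>\<open>rho_star\<close> is a value of the total operator \<open>lim\<close>, which says nothing until convergence is known;
  it holds because the spectral radii decrease from level \<open>1\<close> on.\<close>

lemma tendsto_rho_star:
  assumes weight: "word_weight (letters N) (s_bar N x y S)" and N: "N \<ge> 1"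
  shows "(\<lambda>n. spectral_radius (M_bar N x y S n)) \<longlonglongrightarrow> rho_star N x y S"
proof -
  let ?\<rho> = "\<lambda>n. spectral_radius (M_bar N x y S (Suc n))"
  have dec: "decseq ?\<rho>"
    by (intro decseq_SucI spectral_radius_M_bar_Suc_le[OF weight N]) simp
  have nonneg: "\<forall>n. 0 \<le> ?\<rho> n"
    using spectral_radius_nonneg[OF M_bar_carrier length_words_pos[OF N]] by blast
  obtain l where "?\<rho> \<longlonglongrightarrow> l"
    by (rule decseq_convergent[OF dec nonneg])
  then have "(\<lambda>n. spectral_radius (M_bar N x y S n)) \<longlonglongrightarrow> l"
    by (rule LIMSEQ_imp_Suc)
  then show ?thesis unfolding rho_star_def by (simp add: limI)
qed

section \<open>Counting grid cubes\<close>

definition cube_hits :: "'a :: euclidean_space set \<Rightarrow> real \<Rightarrow> 'a set set" where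
  "cube_hits E \<epsilon> = {Q. (\<exists>n. Q = grid_cube \<epsilon> n) \<and> Q \<inter> E \<noteq> {}}"

lemma box_count_eq_card_cube_hits: "box_count E \<epsilon> = card (cube_hits E \<epsilon>)"
  by (simp add: box_count_def cube_hits_def)

text \<open>A cube depends on its index function only through three integers, so that cubes,
  counted as sets, can be counted by triples of integers.\<close>

lemma grid_cube_real3:
  "grid_cube \<epsilon> n =
    {of_int (n (1, 0, 0)) * \<epsilon>..(of_int (n (1, 0, 0)) + 1) * \<epsilon>} \<times>
    {of_int (n (0, 1, 0)) * \<epsilon>..(of_int (n (0, 1, 0)) + 1) * \<epsilon>} \<times>
    {of_int (n (0, 0, 1)) * \<epsilon>..(of_int (n (0, 0, 1)) + 1) * \<epsilon> :: real}"
proof -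
  have "p \<in> grid_cube \<epsilon> n \<longleftrightarrow> (\<forall>b\<in>Basis. of_int (n b) * \<epsilon> \<le> p \<bullet> b \<and> p \<bullet> b \<le> (of_int (n b) + 1) * \<epsilon>)"
    for p by (simp add: grid_cube_def mem_box inner_sum_left_Basis)
  then show ?thesis
    by (auto simp: Basis_prod_def zero_prod_def)
qed

text \<open>For \<open>\<epsilon> > 0\<close>, the integers \<open>k\<close> for which \<open>[k \<epsilon>, (k + 1) \<epsilon>]\<close> meets \<open>[a, b]\<close>. The intervals are closed, so
  those that only touch \<open>[a, b]\<close> at an end point are included.\<close>

definition hit_range :: "real \<Rightarrow> real \<Rightarrow> real \<Rightarrow> int set" where
  "hit_range \<epsilon> a b = {\<lceil>a / \<epsilon>\<rceil> - 1..\<lfloor>b / \<epsilon>\<rfloor>}"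

lemma hit_rangeI:
  assumes "of_int k * \<epsilon> \<le> t" "t \<le> (of_int k + 1) * \<epsilon>" "a \<le> t" "t \<le> b" "\<epsilon> > 0"
  shows "k \<in> hit_range \<epsilon> a b"
proof -
  have "a / \<epsilon> \<le> of_int (k + 1)" "of_int k \<le> b / \<epsilon>"
    using assms by (auto simp: field_simps)
  then show ?thesis by (simp add: hit_range_def le_floor_iff) linarith
qed

lemma card_hit_range_le:
  assumes "a \<le> b" "\<epsilon> > 0"
  shows "real (card (hit_range \<epsilon> a b)) \<le> (b - a) / \<epsilon> + 2"
proof -
  have "a / \<epsilon> \<le> b / \<epsilon>" using assms by (simp add: divide_right_mono)
  moreover have "of_int \<lfloor>b / \<epsilon>\<rfloor> \<le> b / \<epsilon>" "a / \<epsilon> \<le> of_int \<lceil>a / \<epsilon>\<rceil>" by linarith+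
  moreover have "real (card (hit_range \<epsilon> a b)) = max 0 (of_int (\<lfloor>b / \<epsilon>\<rfloor> - \<lceil>a / \<epsilon>\<rceil> + 2))"
    by (simp add: hit_range_def)
  ultimately show ?thesis unfolding diff_divide_distrib of_int_add of_int_diff by linarith
qed

lemma cube_hits_rectangle:
  assumes E: "E \<subseteq> {a1..b1} \<times> {a2..b2} \<times> {a3..b3 :: real}"
    and le: "a1 \<le> b1" "a2 \<le> b2" "a3 \<le> b3" and \<epsilon>: "\<epsilon> > 0"
  shows "finite (cube_hits E \<epsilon>)"
    and "real (card (cube_hits E \<epsilon>))
      \<le> ((b1 - a1) / \<epsilon> + 2) * ((b2 - a2) / \<epsilon> + 2) * ((b3 - a3) / \<epsilon> + 2)"
proof -
  let ?Z = "hit_range \<epsilon> a1 b1 \<times> hit_range \<epsilon> a2 b2 \<times> hit_range \<epsilon> a3 b3"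
  let ?I = "\<lambda>k. {of_int k * \<epsilon>..(of_int k + 1) * \<epsilon>}"
  have fin: "finite ?Z" by (simp add: hit_range_def)
  have sub: "cube_hits E \<epsilon> \<subseteq> (\<lambda>(i, j, k). ?I i \<times> ?I j \<times> ?I k) ` ?Z"
  proof
    fix Q assume "Q \<in> cube_hits E \<epsilon>"
    then obtain n s t u where Q: "Q = grid_cube \<epsilon> n"
      and stu: "(s, t, u) \<in> grid_cube \<epsilon> n" "(s, t, u) \<in> E"
      by (auto simp: cube_hits_def)
    have "s \<in> {a1..b1}" "t \<in> {a2..b2}" "u \<in> {a3..b3}" using stu(2) E by auto
    then have "n (1, 0, 0) \<in> hit_range \<epsilon> a1 b1" "n (0, 1, 0) \<in> hit_range \<epsilon> a2 b2"
      "n (0, 0, 1) \<in> hit_range \<epsilon> a3 b3"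
      using stu(1) \<epsilon> unfolding grid_cube_real3
      by (auto intro: hit_rangeI[of _ \<epsilon> s] hit_rangeI[of _ \<epsilon> t] hit_rangeI[of _ \<epsilon> u])
    then show "Q \<in> (\<lambda>(i, j, k). ?I i \<times> ?I j \<times> ?I k) ` ?Z"
      unfolding Q grid_cube_real3 by (intro image_eqI[where x = "(n (1, 0, 0), n (0, 1, 0), n (0, 0, 1))"]) auto
  qed
  then show "finite (cube_hits E \<epsilon>)" using fin by (rule finite_subset[OF _ finite_imageI])
  have "card (cube_hits E \<epsilon>) \<le> card ?Z"
    using card_mono[OF finite_imageI[OF fin] sub] card_image_le[OF fin] by (rule order_trans)
  then have "real (card (cube_hits E \<epsilon>)) \<le> real (card ?Z)" by simp
  also have "\<dots> \<le> ((b1 - a1) / \<epsilon> + 2) * (((b2 - a2) / \<epsilon> + 2) * ((b3 - a3) / \<epsilon> + 2))"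
    unfolding card_cartesian_product of_nat_mult using le \<epsilon>
    by (intro mult_mono card_hit_range_le) (auto intro!: add_nonneg_nonneg mult_nonneg_nonneg)
  finally show "real (card (cube_hits E \<epsilon>))
      \<le> ((b1 - a1) / \<epsilon> + 2) * ((b2 - a2) / \<epsilon> + 2) * ((b3 - a3) / \<epsilon> + 2)"
    by (simp add: mult.assoc)
qed

lemma box_count_UN_le:
  assumes "finite W" "E \<subseteq> (\<Union>w\<in>W. F w)" "\<And>w. w \<in> W \<Longrightarrow> finite (cube_hits (F w) \<epsilon>)"
  shows "box_count E \<epsilon> \<le> (\<Sum>w\<in>W. card (cube_hits (F w) \<epsilon>))"
proof -
  have "cube_hits E \<epsilon> \<subseteq> (\<Union>w\<in>W. cube_hits (F w) \<epsilon>)"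
    using assms(2) by (force simp: cube_hits_def)
  then have "card (cube_hits E \<epsilon>) \<le> card (\<Union>w\<in>W. cube_hits (F w) \<epsilon>)"
    using assms by (intro card_mono) auto
  also have "\<dots> \<le> (\<Sum>w\<in>W. card (cube_hits (F w) \<epsilon>))" using assms(1) by (rule card_UN_le)
  finally show ?thesis by (simp add: box_count_eq_card_cube_hits)
qed

text \<open>The multiplicative constant contributes \<open>ln C / ln (1 / \<epsilon>)\<close>, which vanishes in the limit.\<close>

lemma upper_box_dim_le:
  assumes C: "C > 0" and p: "p \<ge> 0"
    and count: "\<forall>\<^sub>F \<epsilon> in at_right 0. real (box_count E \<epsilon>) \<le> C * (1 / \<epsilon>) powr p"
  shows "upper_box_dim E \<le> ereal p"
proof -
  have "upper_box_dim E \<le> Limsup (at_right 0) (\<lambda>\<epsilon>. ereal (p + ln C / ln (1 / \<epsilon>)))"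
    unfolding upper_box_dim_def
  proof (rule Limsup_mono)
    have "\<forall>\<^sub>F \<epsilon> in at_right (0::real). 0 < \<epsilon> \<and> \<epsilon> < 1"
      by (rule eventually_at_rightI[of 0 1]) auto
    with count show "\<forall>\<^sub>F \<epsilon> in at_right 0. elog (real (box_count E \<epsilon>)) / ereal (ln (1 / \<epsilon>))
        \<le> ereal (p + ln C / ln (1 / \<epsilon>))"
    proof eventually_elim
      case (elim \<epsilon>)
      then have l: "ln (1 / \<epsilon>) > 0" by (simp add: ln_div)
      show ?case
      proof (cases "box_count E \<epsilon> = 0")
        case True
        then show ?thesis using l by (simp add: elog_def)
      next
        case False
        then have "ln (real (box_count E \<epsilon>)) \<le> ln (C * (1 / \<epsilon>) powr p)"
          using elim C by (subst ln_le_cancel_iff) auto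
        also have "\<dots> = ln C + p * ln (1 / \<epsilon>)" using elim C by (simp add: ln_mult ln_powr)
        finally have "ln (real (box_count E \<epsilon>)) / ln (1 / \<epsilon>) \<le> p + ln C / ln (1 / \<epsilon>)"
          using l by (simp add: field_simps)
        then show ?thesis using False l by (simp add: elog_def)
      qed
    qed
  qed
  also have "\<dots> = ereal p"
  proof (rule lim_imp_Limsup)
    have "filterlim (\<lambda>\<epsilon>::real. ln (1 / \<epsilon>)) at_top (at_right 0)" by real_asymp
    then have "((\<lambda>\<epsilon>. p + ln C / ln (1 / \<epsilon>)) \<longlongrightarrow> p + 0) (at_right 0)"
      by (intro tendsto_intros tendsto_divide_0[OF tendsto_const] filterlim_at_top_imp_at_infinity)
    then show "((\<lambda>\<epsilon>. ereal (p + ln C / ln (1 / \<epsilon>))) \<longlongrightarrow> ereal p) (at_right 0)"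
      by simp
  qed simp
  finally show ?thesis .
qed

section \<open>The oscillation of a fractal surface on its cells\<close>

text \<open>This is the recursion that the functional equation of \<open>f\<close> imposes on its oscillation over cells:
  the oscillation over the cell of \<open>w\<close> is contracted by the vertical scaling on the cell of
  \<open>a # w\<close>, and the variation of \<open>S\<close> and \<open>q\<close> on that cell adds an error proportional to its diameter.\<close>

fun osc_bound :: "('a list \<Rightarrow> real) \<Rightarrow> real \<Rightarrow> real \<Rightarrow> nat \<Rightarrow> 'a list \<Rightarrow> real" where
  "osc_bound s K c N [] = K"
| "osc_bound s K c N (a # w) = s (a # w) * osc_bound s K c N w + c / N ^ length w"

lemma uniform_nodes_less:
  assumes "uniform_nodes N x" "N \<ge> 1"
  shows "x 0 < x N"
proof -
  have "x (1 - 1) < x 1 \<and> x 1 - x (1 - 1) = (x N - x 0) / N"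
    using assms unfolding uniform_nodes_def by (elim ballE[where x = 1]) auto
  then have "0 < (x N - x 0) / N" by simp
  then show ?thesis by (simp add: zero_less_divide_iff)
qed

lemma abs_edge_map_diff:
  assumes x: "uniform_nodes N x" and N: "N \<ge> 1" and i: "i \<in> {1..N}"
  shows "\<bar>edge_map N x i s - edge_map N x i t\<bar> = \<bar>s - t\<bar> / N"
proof -
  define l where "l = x N - x 0"
  have l: "l > 0" using uniform_nodes_less[OF x N] by (simp add: l_def)
  have d: "x i - x (i - 1) = l / N" using x i by (auto simp: uniform_nodes_def l_def)
  then have d': "x (i - 1) - x i = - (l / N)" by linarith
  have affine_diff: "affine_map a b c d s - affine_map a b c d t = (d - c) * (s - t) / (b - a)" for a b c d
    by (simp add: affine_map_def right_diff_distrib diff_divide_distrib)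
  have "edge_map N x i s - edge_map N x i t = (if odd i then 1 else - 1) * (l / N) * (s - t) / l"
  proof (cases "odd i")
    case True
    then show ?thesis
      by (simp only: edge_map_def if_True not_False_eq_True affine_diff d l_def[symmetric] mult_1)
  next
    case False
    then show ?thesis
      by (simp only: edge_map_def if_False not_True_eq_False not_not affine_diff d' l_def[symmetric] mult_minus1)
  qed
  also have "\<dots> = (if odd i then 1 else - 1) * ((s - t) / N)" using l by simp
  finally show ?thesis by (auto simp: abs_mult)
qed

lemma L_word_Nil [simp]: "L_word N x y [] = id"
  by (simp add: L_word_def)

lemma L_word_Cons [simp]: "L_word N x y (a # w) = L_map N x y a \<circ> L_word N x y w"
  by (simp add: L_word_def)

lemma L_word_append: "L_word N x y (v @ w) = L_word N x y v \<circ> L_word N x y w"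
  by (induction v) (simp_all add: comp_assoc)

text \<open>This selects the level at which the cells have about the size of the cubes.\<close>

lemma power_bracket:
  fixes b t :: real
  assumes b: "b > 1" and t: "t \<ge> 1"
  obtains k where "t \<le> b ^ k" "b ^ k \<le> b * t"
proof -
  obtain n where "t < b ^ n" using real_arch_pow[OF b, of t] by (elim exE)
  then have "\<exists>k. t \<le> b ^ k" using less_imp_le by blast
  then obtain k where k: "t \<le> b ^ k" "\<forall>j<k. \<not> t \<le> b ^ j"
    using exists_least_iff[of "\<lambda>k. t \<le> b ^ k"] by auto
  have "b ^ k \<le> b * t"
  proof (cases k)
    case 0
    then show ?thesis using b t mult_mono[of 1 b 1 t] by simp
  next
    case (Suc j)
    then have "b ^ j \<le> t" using k(2) by auto
    then show ?thesis using b by (simp add: Suc)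
  qed
  with k(1) show ?thesis by (rule that)
qed

locale fractal_surface =
  fixes N :: nat and x y :: "nat \<Rightarrow> real" and S q f :: "real \<times> real \<Rightarrow> real"
    and D :: "(real \<times> real) set" and cS cq :: real
  assumes N: "N \<ge> 2"
    and nodes: "uniform_nodes N x" "uniform_nodes N y"
    and D: "D = dom_rect N x y"
    and S_bound: "t \<in> D \<Longrightarrow> \<bar>S t\<bar> \<le> 1"
    and f_continuous: "continuous_on D f"
    and self_referential: "surface D f = (\<Union>w\<in>letters N. Psi_map N x y S q w ` surface D f)"
    and S_Lipschitz: "cS-lipschitz_on D S"
    and q_Lipschitz: "cq-lipschitz_on D q"
begin

text \<open>Both facts are read off from the inclusion of the pieces in the surface; the reverse inclusion
  gives the covering of \<open>D\<close> by its cells.\<close>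

lemma functional_equation:
  assumes "a \<in> letters N" "t \<in> D"
  shows "L_map N x y a t \<in> D"
    and "f (L_map N x y a t) = S (L_map N x y a t) * f t + q (L_map N x y a t)"
proof -
  obtain t1 t2 where t: "t = (t1, t2)" by (cases t)
  have "(t1, t2, f (t1, t2)) \<in> surface D f" using assms(2) by (simp add: surface_def t)
  then have "Psi_map N x y S q a (t1, t2, f (t1, t2)) \<in> (\<Union>w\<in>letters N. Psi_map N x y S q w ` surface D f)"
    by (intro UN_I[OF assms(1)] imageI)
  then have "Psi_map N x y S q a (t1, t2, f (t1, t2)) \<in> surface D f"
    unfolding self_referential[symmetric] .
  then show "L_map N x y a t \<in> D"
    and "f (L_map N x y a t) = S (L_map N x y a t) * f t + q (L_map N x y a t)"
    by (simp_all add: surface_def Psi_map_def F_map_def L_map_def t)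
qed

lemma D_subset_images: "D \<subseteq> (\<Union>a\<in>letters N. L_map N x y a ` D)"
proof
  fix t assume "t \<in> D"
  then have "(fst t, snd t, f t) \<in> surface D f" by (simp add: surface_def)
  then have "(fst t, snd t, f t) \<in> (\<Union>w\<in>letters N. Psi_map N x y S q w ` surface D f)"
    by (rule subsetD[OF equalityD1[OF self_referential]])
  then obtain a p where a: "a \<in> letters N" and p: "p \<in> surface D f"
    "(fst t, snd t, f t) = Psi_map N x y S q a p"
    by (elim UN_E imageE)
  from p(1) obtain s1 s2 where s: "(s1, s2) \<in> D" "p = (s1, s2, f (s1, s2))"
    by (auto simp: surface_def)
  have "t = L_map N x y a (s1, s2)"
    using p(2) by (simp add: s(2) Psi_map_def L_map_def prod_eq_iff)
  with a s(1) show "t \<in> (\<Union>a\<in>letters N. L_map N x y a ` D)" by blast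
qed

lemma corner_in_D: "(x 0, y 0) \<in> D"
  using uniform_nodes_less[OF nodes(1)] uniform_nodes_less[OF nodes(2)] N
  by (simp add: D dom_rect_def)

lemma compact_D: "compact D"
  by (simp add: D dom_rect_def compact_Times)

lemma D_word_eq: "D_word N x y w = L_word N x y w ` D"
  by (simp add: D_word_def D)

lemma L_word_in_D: "set w \<subseteq> letters N \<Longrightarrow> t \<in> D \<Longrightarrow> L_word N x y w t \<in> D"
  by (induction w) (simp_all add: functional_equation(1))

lemma D_word_subset: "set w \<subseteq> letters N \<Longrightarrow> D_word N x y w \<subseteq> D"
  unfolding D_word_eq by (intro image_subsetI L_word_in_D)

lemma D_subset_D_words: "D \<subseteq> (\<Union>w\<in>word_set (letters N) n. D_word N x y w)"
proof (induction n)
  case 0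
  have "D = D_word N x y []" by (simp add: D_word_eq)
  also have "\<dots> \<subseteq> (\<Union>w\<in>word_set (letters N) 0. D_word N x y w)" by (rule UN_upper) simp
  finally show ?case .
next
  case (Suc n)
  show ?case
  proof
    fix t assume "t \<in> D"
    then have "t \<in> (\<Union>a\<in>letters N. L_map N x y a ` D)" by (rule subsetD[OF D_subset_images])
    then obtain a s where a: "a \<in> letters N" "s \<in> D" "t = L_map N x y a s"
      by (elim UN_E imageE)
    obtain w where w: "w \<in> word_set (letters N) n" "s \<in> D_word N x y w"
      using subsetD[OF Suc a(2)] by (elim UN_E)
    then have "a # w \<in> word_set (letters N) (Suc n)" using a by simp
    moreover have "t \<in> D_word N x y (a # w)"
      using w(2) unfolding D_word_eq a(3) L_word_Cons image_comp[symmetric] by (rule imageI)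
    ultimately show "t \<in> (\<Union>w\<in>word_set (letters N) (Suc n). D_word N x y w)" by (rule UN_I)
  qed
qed

lemma abs_S_le_s_bar:
  assumes "set w \<subseteq> letters N" "t \<in> D_word N x y w"
  shows "\<bar>S t\<bar> \<le> s_bar N x y S w"
  unfolding s_bar_def using D_word_subset[OF assms(1)] S_bound assms(2)
  by (intro cSUP_upper bdd_aboveI2[where M = 1]) auto

lemma word_weight_s_bar: "word_weight (letters N) (s_bar N x y S)"
proof
  show "finite (letters N)" by (simp add: letters_def)
next
  fix w assume w: "set w \<subseteq> letters N"
  have "L_word N x y w (x 0, y 0) \<in> D_word N x y w" using corner_in_D by (simp add: D_word_eq)
  from abs_S_le_s_bar[OF w this] show "0 \<le> s_bar N x y S w" by linarith
next
  fix w a assume w: "set w \<subseteq> letters N" and a: "a \<in> letters N"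
  have "D_word N x y (w @ [a]) \<subseteq> D_word N x y w"
    using functional_equation(1)[OF a] by (auto simp: D_word_eq L_word_append)
  moreover have "D_word N x y (w @ [a]) \<noteq> {}" using corner_in_D by (auto simp: D_word_eq)
  ultimately show "s_bar N x y S (w @ [a]) \<le> s_bar N x y S w"
    unfolding s_bar_def using D_word_subset[OF w] S_bound
    by (intro cSUP_subset_mono bdd_aboveI2[where M = 1]) auto
qed

lemma dist_L_map:
  assumes a: "a \<in> letters N"
  shows "dist (L_map N x y a s) (L_map N x y a t) = dist s t / N"
proof -
  have i: "fst a \<in> {1..N}" "snd a \<in> {1..N}" and N1: "N \<ge> 1"
    using a N by (auto simp: letters_def)
  have "dist (L_map N x y a s) (L_map N x y a t)
      = sqrt ((\<bar>fst s - fst t\<bar> / N)\<^sup>2 + (\<bar>snd s - snd t\<bar> / N)\<^sup>2)"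
    unfolding L_map_def dist_Pair_Pair dist_real_def
      abs_edge_map_diff[OF nodes(1) N1 i(1)] abs_edge_map_diff[OF nodes(2) N1 i(2)] ..
  also have "\<dots> = sqrt ((\<bar>fst s - fst t\<bar>\<^sup>2 + \<bar>snd s - snd t\<bar>\<^sup>2) / (real N)\<^sup>2)"
    unfolding power_divide add_divide_distrib ..
  also have "\<dots> = dist s t / N"
    unfolding dist_prod_def dist_real_def real_sqrt_divide by simp
  finally show ?thesis .
qed

lemma dist_L_word:
  "set w \<subseteq> letters N \<Longrightarrow> dist (L_word N x y w s) (L_word N x y w t) = dist s t / N ^ length w"
proof (induction w)
  case (Cons a w)
  then have "a \<in> letters N" "set w \<subseteq> letters N" by auto
  then show ?case using Cons.IH dist_L_map[of a] by simp
qed simp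

text \<open>Writing \<open>f(s'') - f(t'')\<close> by the functional equation as
  \<open>S(s'') (f(s') - f(t')) + (S(s'') - S(t'')) f(t') + (q(s'') - q(t''))\<close> separates the
  contracted oscillation one level up from the two Lipschitz errors.\<close>

lemma osc_le:
  assumes F: "\<And>t. t \<in> D \<Longrightarrow> \<bar>f t\<bar> \<le> F"
    and \<Delta>: "\<And>s t. s \<in> D \<Longrightarrow> t \<in> D \<Longrightarrow> dist s t \<le> \<Delta>"
    and w: "set w \<subseteq> letters N" and st: "s \<in> D" "t \<in> D"
  shows "\<bar>f (L_word N x y w s) - f (L_word N x y w t)\<bar>
    \<le> osc_bound (s_bar N x y S) (2 * F) ((cS * F + cq) * \<Delta>) N w"
  using w
proof (induction w)
  case Nil
  show ?case using F[OF st(1)] F[OF st(2)] by simp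
next
  case (Cons a w)
  define s' t' where "s' = L_word N x y w s" and "t' = L_word N x y w t"
  define s'' t'' where "s'' = L_map N x y a s'" and "t'' = L_map N x y a t'"
  have a: "a \<in> letters N" "set w \<subseteq> letters N" using Cons.prems by auto
  have D': "s' \<in> D" "t' \<in> D" using L_word_in_D a st by (auto simp: s'_def t'_def)
  have D'': "s'' \<in> D" "t'' \<in> D" using functional_equation(1) a D' by (auto simp: s''_def t''_def)
  have c: "cS \<ge> 0" "cq \<ge> 0" using S_Lipschitz q_Lipschitz by (auto simp: lipschitz_on_nonneg)
  have "0 \<le> \<bar>f s\<bar>" by simp
  also have "\<dots> \<le> F" by (rule F[OF st(1)])
  finally have F0: "F \<ge> 0" .
  have "0 \<le> dist s t" by simp
  also have "\<dots> \<le> \<Delta>" by (rule \<Delta>[OF st])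
  finally have \<Delta>0: "\<Delta> \<ge> 0" .
  have "dist s'' t'' = dist s t / N ^ Suc (length w)"
    using dist_L_word[OF Cons.prems, of s t] by (simp add: s''_def t''_def s'_def t'_def)
  also have "\<dots> \<le> \<Delta> / N ^ length w"
    using \<Delta>[OF st] \<Delta>0 N by (intro frac_le) (auto intro!: power_increasing simp del: power_Suc)
  finally have dist: "dist s'' t'' \<le> \<Delta> / N ^ length w" .
  have "\<bar>S s''\<bar> \<le> s_bar N x y S (a # w)"
    using st by (intro abs_S_le_s_bar Cons.prems) (auto simp: D_word_eq s''_def s'_def)
  then have 1: "\<bar>S s'' * (f s' - f t')\<bar>
      \<le> s_bar N x y S (a # w) * osc_bound (s_bar N x y S) (2 * F) ((cS * F + cq) * \<Delta>) N w"
    unfolding abs_mult using Cons.IH[OF a(2)] by (intro mult_mono) (auto simp: s'_def t'_def)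
  have "\<bar>S s'' - S t''\<bar> \<le> cS * dist s'' t''"
    using lipschitz_onD[OF S_Lipschitz D''] by (simp add: dist_real_def)
  then have 2: "\<bar>(S s'' - S t'') * f t'\<bar> \<le> cS * dist s'' t'' * F"
    unfolding abs_mult using F[OF D'(2)] c by (intro mult_mono) auto
  have 3: "\<bar>q s'' - q t''\<bar> \<le> cq * dist s'' t''"
    using lipschitz_onD[OF q_Lipschitz D''] by (simp add: dist_real_def)
  have "f s'' - f t'' = S s'' * (f s' - f t') + (S s'' - S t'') * f t' + (q s'' - q t'')"
    using functional_equation(2)[OF a(1)] D' by (simp add: s''_def t''_def algebra_simps)
  then have "\<bar>f s'' - f t''\<bar>
      \<le> s_bar N x y S (a # w) * osc_bound (s_bar N x y S) (2 * F) ((cS * F + cq) * \<Delta>) N w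
        + (cS * F + cq) * dist s'' t''"
    using 1 2 3 by (simp add: algebra_simps)
  also have "(cS * F + cq) * dist s'' t'' \<le> (cS * F + cq) * (\<Delta> / N ^ length w)"
    using dist c F0 by (intro mult_left_mono) auto
  finally show ?case by (simp add: s''_def t''_def s'_def t'_def)
qed

section \<open>The dimension bound\<close>

text \<open>Over a cell of diameter at most \<open>\<epsilon>\<close> the surface lies in a box with base of side \<open>2 \<epsilon>\<close> and height
  \<open>2 b w\<close>; the base is met by at most \<open>4\<close> columns of cubes in each direction, whence the \<open>16\<close>.\<close>

lemma box_count_le_sum_osc:
  assumes \<epsilon>: "\<epsilon> > 0" and \<Delta>: "\<And>s t. s \<in> D \<Longrightarrow> t \<in> D \<Longrightarrow> dist s t \<le> \<Delta>" and m: "\<Delta> / N ^ m \<le> \<epsilon>"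
    and b: "\<And>w s t. w \<in> word_set (letters N) m \<Longrightarrow> s \<in> D \<Longrightarrow> t \<in> D \<Longrightarrow>
      \<bar>f (L_word N x y w s) - f (L_word N x y w t)\<bar> \<le> b w"
  shows "real (box_count (surface D f) \<epsilon>) \<le> (\<Sum>w\<in>word_set (letters N) m. 16 * (2 * b w / \<epsilon> + 2))"
proof -
  let ?W = "word_set (letters N) m"
  let ?F = "\<lambda>w. surface (D_word N x y w) f"
  have piece: "finite (cube_hits (?F w) \<epsilon>)"
    "real (card (cube_hits (?F w) \<epsilon>)) \<le> 16 * (2 * b w / \<epsilon> + 2)" if w: "w \<in> ?W" for w
  proof -
    define t where "t = L_word N x y w (x 0, y 0)"
    have "0 \<le> dist (x 0, y 0) (x 0, y 0)" by simp
    also have "\<dots> \<le> b w" using b[OF w corner_in_D corner_in_D] by simp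
    finally have b0: "b w \<ge> 0" .
    have near: "\<bar>fst s - fst t\<bar> \<le> \<epsilon>" "\<bar>snd s - snd t\<bar> \<le> \<epsilon>" "\<bar>f s - f t\<bar> \<le> b w"
      if s: "s \<in> D_word N x y w" for s
    proof -
      obtain s' where s': "s' \<in> D" "s = L_word N x y w s'"
        using s unfolding D_word_eq by blast
      have "dist s t = dist s' (x 0, y 0) / N ^ m"
        using dist_L_word[of w] w s' by (auto simp: t_def)
      also have "\<dots> \<le> \<Delta> / N ^ m" using \<Delta>[OF s'(1) corner_in_D] by (simp add: divide_right_mono)
      finally have "dist s t \<le> \<epsilon>" using m by simp
      then show "\<bar>fst s - fst t\<bar> \<le> \<epsilon>" "\<bar>snd s - snd t\<bar> \<le> \<epsilon>"
        using dist_fst_le[of s t] dist_snd_le[of s t] by (auto simp: dist_real_def)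
      show "\<bar>f s - f t\<bar> \<le> b w" using b[OF w s'(1) corner_in_D] s' by (simp add: t_def)
    qed
    have sub: "?F w \<subseteq> {fst t - \<epsilon>..fst t + \<epsilon>} \<times> {snd t - \<epsilon>..snd t + \<epsilon>} \<times> {f t - b w..f t + b w}"
    proof
      fix p assume "p \<in> ?F w"
      then obtain s where "s \<in> D_word N x y w" "p = (fst s, snd s, f s)" by (auto simp: surface_def)
      with near[of s] show "p \<in> {fst t - \<epsilon>..fst t + \<epsilon>} \<times> {snd t - \<epsilon>..snd t + \<epsilon>} \<times> {f t - b w..f t + b w}"
        by (auto simp: abs_le_iff)
    qed
    note hits = cube_hits_rectangle[OF sub _ _ _ \<epsilon>]
    show "finite (cube_hits (?F w) \<epsilon>)" using hits(1) b0 \<epsilon> by simp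
    show "real (card (cube_hits (?F w) \<epsilon>)) \<le> 16 * (2 * b w / \<epsilon> + 2)"
      using hits(2) b0 \<epsilon> by simp
  qed
  have "surface D f \<subseteq> (\<Union>w\<in>?W. ?F w)"
  proof
    fix p assume "p \<in> surface D f"
    then obtain s where s: "s \<in> D" "p = (fst s, snd s, f s)" by (auto simp: surface_def)
    then obtain w where "w \<in> ?W" "s \<in> D_word N x y w" using D_subset_D_words[of m] by blast
    then show "p \<in> (\<Union>w\<in>?W. ?F w)" unfolding s(2) by (intro UN_I[of w]) (simp_all add: surface_def)
  qed
  then have "box_count (surface D f) \<epsilon> \<le> (\<Sum>w\<in>?W. card (cube_hits (?F w) \<epsilon>))"
    by (intro box_count_UN_le finite_word_set piece(1)) (simp_all add: letters_def)
  then have "real (box_count (surface D f) \<epsilon>) \<le> (\<Sum>w\<in>?W. real (card (cube_hits (?F w) \<epsilon>)))"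
    unfolding of_nat_sum[symmetric] by (simp only: of_nat_le_iff)
  also have "\<dots> \<le> (\<Sum>w\<in>?W. 16 * (2 * b w / \<epsilon> + 2))" by (intro sum_mono piece(2))
  finally show ?thesis .
qed

text \<open>At scale \<open>\<epsilon>\<close> take \<open>N\<^sup>k\<close> of the order of \<open>1 / \<epsilon>\<close> and use the cells of level \<open>n + k\<close>. The
  oscillations over them sum to \<open>O(r\<^sup>k)\<close>, which gives \<open>O(r\<^sup>k / \<epsilon> + N\<^sup>2\<^sup>k)\<close> cubes; both terms are
  \<open>O((1 / \<epsilon>)\<^sup>1\<^sup>+\<^sup>p)\<close> with \<open>N\<^sup>p = r\<close>, the second because \<open>r \<ge> N\<close>.\<close>

lemma upper_box_dim_le_of_spectral_radius_less:
  fixes r :: real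
  assumes n: "n \<ge> 1" and r: "r \<ge> N" "spectral_radius (M_bar N x y S n) < r"
  shows "upper_box_dim (surface D f) \<le> ereal (1 + ln r / ln N)"
proof -
  let ?A = "letters N"
  interpret word_weight ?A "s_bar N x y S" by (rule word_weight_s_bar)
  define p where "p = ln r / ln N"
  have r0: "r > 0" and N1: "real N > 1" using r N by auto
  have p: "p \<ge> 1" "N powr p = r" using r N1 by (auto simp: p_def powr_def)
  obtain u where u: "supersolution ?A (s_bar N x y S) n r u"
    using supersolution_of_spectral_radius_less[OF word_weight_s_bar n r(2) r0] .
  have "bounded (f ` D)" by (intro compact_imp_bounded compact_continuous_image f_continuous compact_D)
  then obtain F where "F > 0" "\<forall>s\<in>f ` D. norm s \<le> F"
    unfolding bounded_pos by (elim exE conjE)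
  then have F: "F > 0" "\<And>t. t \<in> D \<Longrightarrow> \<bar>f t\<bar> \<le> F" by auto
  obtain \<Delta>0 where \<Delta>0: "\<forall>s\<in>D. \<forall>t\<in>D. dist s t \<le> \<Delta>0"
    using compact_imp_bounded[OF compact_D] unfolding bounded_two_points by (elim exE)
  \<comment> \<open>A positive bound for the diameter of \<open>D\<close>.\<close>
  define \<Delta> where "\<Delta> = max 1 \<Delta>0"
  have \<Delta>: "\<Delta> > 0" "\<And>s t. s \<in> D \<Longrightarrow> t \<in> D \<Longrightarrow> dist s t \<le> \<Delta>"
    unfolding \<Delta>_def using bspec[OF bspec[OF \<Delta>0]] by (simp, intro max.coboundedI2)
  define c where "c = (cS * F + cq) * \<Delta>"
  have c: "c \<ge> 0"
    unfolding c_def using F \<Delta> S_Lipschitz q_Lipschitz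
    by (intro mult_nonneg_nonneg add_nonneg_nonneg) (auto simp: lipschitz_on_nonneg)
  define b where "b = osc_bound (s_bar N x y S) (2 * F) c N"
  have b_nonneg: "0 \<le> b w" if "set w \<subseteq> ?A" for w
    using that
  proof (induction w)
    case (Cons a w)
    then show ?case using weight_nonneg[OF Cons.prems] c by (simp add: b_def)
  qed (use F(1) in \<open>simp add: b_def\<close>)
  have b_Cons: "b (a # w) \<le> s_bar N x y S (a # w) * b w + c / N ^ length w" for a w
    by (simp add: b_def)
  have card_A: "card ?A = N ^ 2" by (simp add: letters_def power2_eq_square)
  obtain B where B: "B \<ge> 0" "\<forall>k. (\<Sum>w\<in>word_set ?A (n + k). b w) \<le> B * r ^ k"
  proof (rule sum_affine_recursion_le[where b = b and c = c, OF u n card_A _ r(1)])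
    show "N \<ge> 1" using N by simp
    show "0 \<le> b w" if "set w \<subseteq> ?A" for w using that by (rule b_nonneg)
    show "b (a # w) \<le> s_bar N x y S (a # w) * b w + c / N ^ length w" for a w by (rule b_Cons)
    show "c \<ge> 0" by (rule c)
  qed
  define C where "C = 32 * B * (N * \<Delta>) powr p + 32 * real N ^ (2 * n) * (N * \<Delta>) powr (1 + p)"
  have "upper_box_dim (surface D f) \<le> ereal (1 + p)"
  proof (rule upper_box_dim_le)
    show "0 < C" using B N1 \<Delta> unfolding C_def by (intro add_nonneg_pos mult_pos_pos mult_nonneg_nonneg) auto
    have "\<forall>\<^sub>F \<epsilon> in at_right 0. \<epsilon> \<in> {0<..<\<Delta>}" using \<Delta> by (intro eventually_at_right_real)
    then show "\<forall>\<^sub>F \<epsilon> in at_right 0. real (box_count (surface D f) \<epsilon>) \<le> C * (1 / \<epsilon>) powr (1 + p)"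
    proof eventually_elim
      case (elim \<epsilon>)
      then have \<epsilon>: "\<epsilon> > 0" "\<epsilon> < \<Delta>" by auto
      obtain k where k: "\<Delta> / \<epsilon> \<le> real N ^ k" "real N ^ k \<le> N * \<Delta> / \<epsilon>"
        using power_bracket[OF N1, of "\<Delta> / \<epsilon>"] \<epsilon> by auto
      have e: "N * \<Delta> / \<epsilon> = N * \<Delta> * (1 / \<epsilon>)" using \<epsilon> by auto
      have "r ^ k = (real N powr p) powr real k" using r0 p(2) by (simp add: powr_realpow)
      also have "\<dots> = (real N powr real k) powr p" unfolding powr_powr by (simp only: mult.commute)
      also have "\<dots> = (real N ^ k) powr p" using N1 by (simp add: powr_realpow)
      also have "\<dots> \<le> (N * \<Delta> / \<epsilon>) powr p" using k(2) p N1 by (intro powr_mono2) auto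
      also have "\<dots> = (N * \<Delta>) powr p * (1 / \<epsilon>) powr p"
        unfolding e by (rule powr_mult)
      finally have rk: "r ^ k \<le> (N * \<Delta>) powr p * (1 / \<epsilon>) powr p" .
      have "(real N ^ k) ^ 2 = (real N ^ k) powr 2" using N1 by simp
      also have "\<dots> \<le> (real N ^ k) powr (1 + p)" using p N1 by (intro powr_mono) auto
      also have "\<dots> \<le> (N * \<Delta> / \<epsilon>) powr (1 + p)" using k(2) p N1 by (intro powr_mono2) auto
      also have "\<dots> = (N * \<Delta>) powr (1 + p) * (1 / \<epsilon>) powr (1 + p)"
        unfolding e by (rule powr_mult)
      finally have Nk: "(real N ^ k) ^ 2 \<le> (N * \<Delta>) powr (1 + p) * (1 / \<epsilon>) powr (1 + p)" .
      have "\<Delta> / N ^ (n + k) \<le> \<Delta> / N ^ k"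
        using \<Delta> N1 by (intro divide_left_mono) (auto intro!: power_increasing)
      also have "\<dots> \<le> \<epsilon>" using k(1) \<epsilon> N1 by (simp add: field_simps)
      finally have "real (box_count (surface D f) \<epsilon>)
          \<le> (\<Sum>w\<in>word_set ?A (n + k). 16 * (2 * b w / \<epsilon> + 2))"
      proof (intro box_count_le_sum_osc[OF \<epsilon>(1) \<Delta>(2)])
        fix w s t assume "w \<in> word_set ?A (n + k)" and st: "s \<in> D" "t \<in> D"
        then have "set w \<subseteq> ?A" by simp
        from osc_le[OF F(2) \<Delta>(2) this st]
        show "\<bar>f (L_word N x y w s) - f (L_word N x y w t)\<bar> \<le> b w" unfolding b_def c_def .
      qed
      also have "\<dots> = 32 / \<epsilon> * (\<Sum>w\<in>word_set ?A (n + k). b w) + 32 * real (card (word_set ?A (n + k)))"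
        by (simp add: sum.distrib sum_distrib_left algebra_simps)
      finally have count: "real (box_count (surface D f) \<epsilon>)
          \<le> 32 / \<epsilon> * (\<Sum>w\<in>word_set ?A (n + k). b w) + 32 * real (card (word_set ?A (n + k)))" .
      have "card (word_set ?A (n + k)) = (N ^ 2) ^ n * (N ^ 2) ^ k"
        unfolding card_word_set[OF finite_alphabet] card_A power_add ..
      also have "\<dots> = N ^ (2 * n) * (N ^ k) ^ 2"
        by (simp only: power_mult[symmetric] mult.commute[of k 2])
      finally have "real (card (word_set ?A (n + k))) = real N ^ (2 * n) * (real N ^ k) ^ 2"
        by (simp only: of_nat_mult of_nat_power)
      also have "\<dots> \<le> real N ^ (2 * n) * ((N * \<Delta>) powr (1 + p) * (1 / \<epsilon>) powr (1 + p))"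
        using Nk by (intro mult_left_mono) auto
      finally have flat: "32 * real (card (word_set ?A (n + k)))
          \<le> 32 * real N ^ (2 * n) * (N * \<Delta>) powr (1 + p) * (1 / \<epsilon>) powr (1 + p)"
        by (simp only: mult.assoc mult_le_cancel_left_pos zero_less_numeral)
      have "32 / \<epsilon> * (\<Sum>w\<in>word_set ?A (n + k). b w) \<le> 32 / \<epsilon> * (B * r ^ k)"
        using B \<epsilon> by (intro mult_left_mono) auto
      also have "\<dots> \<le> 32 / \<epsilon> * (B * ((N * \<Delta>) powr p * (1 / \<epsilon>) powr p))"
        using B \<epsilon> by (intro mult_left_mono rk) auto
      also have "\<dots> = 32 * B * (N * \<Delta>) powr p * (1 / \<epsilon>) powr (1 + p)"
        using \<epsilon> by (simp add: powr_add)
      finally have steep: "32 / \<epsilon> * (\<Sum>w\<in>word_set ?A (n + k). b w)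
          \<le> 32 * B * (N * \<Delta>) powr p * (1 / \<epsilon>) powr (1 + p)" .
      show "real (box_count (surface D f) \<epsilon>) \<le> C * (1 / \<epsilon>) powr (1 + p)"
        unfolding C_def distrib_right by (rule order_trans[OF count add_mono[OF steep flat]])
    qed
  qed (use p in simp)
  then show ?thesis by (simp add: p_def)
qed

text \<open>Every \<open>r\<close> above \<open>max N rho_star\<close> exceeds the spectral radius at some level; let \<open>r\<close> decrease to
  this maximum.\<close>

lemma upper_box_dim_le_rho_star:
  "upper_box_dim (surface D f) \<le> ereal (1 + ln (max N (rho_star N x y S)) / ln N)"
proof -
  define R where "R = max (real N) (rho_star N x y S)"
  have R: "R > 0" using N by (simp add: R_def)
  have le: "upper_box_dim (surface D f) \<le> ereal (1 + ln r / ln N)" if "r > R" for r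
  proof -
    have "\<forall>\<^sub>F n in sequentially. spectral_radius (M_bar N x y S n) < r"
      using tendsto_rho_star[OF word_weight_s_bar] that N
      by (intro order_tendstoD(2)[where y = "rho_star N x y S"]) (auto simp: R_def)
    then obtain m where m: "\<forall>n\<ge>m. spectral_radius (M_bar N x y S n) < r"
      unfolding eventually_sequentially by (elim exE)
    show ?thesis
    proof (rule upper_box_dim_le_of_spectral_radius_less[where n = "max 1 m"])
      show "spectral_radius (M_bar N x y S (max 1 m)) < r" using m by simp
    qed (use that in \<open>simp_all add: R_def\<close>)
  qed
  have "((\<lambda>r. ereal (1 + ln r / ln N)) \<longlongrightarrow> ereal (1 + ln R / ln N)) (at_right R)"
    using R N by (intro tendsto_intros tendsto_ln) auto
  then have "upper_box_dim (surface D f) \<le> ereal (1 + ln R / ln N)"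
  proof (rule tendsto_lowerbound)
    show "\<forall>\<^sub>F r in at_right R. upper_box_dim (surface D f) \<le> ereal (1 + ln r / ln N)"
      using eventually_at_right_less[of R] by (rule eventually_mono) (rule le)
  qed simp
  then show ?thesis by (simp add: R_def)
qed

end

theorem theorem4p1:
  fixes N :: nat and x y :: "nat \<Rightarrow> real" and z :: "nat \<Rightarrow> nat \<Rightarrow> real"
    and g h S q f :: "real \<times> real \<Rightarrow> real" and D :: "(real \<times> real) set"
    and cS cq :: real
  assumes N: "N \<ge> 2"
    and nodes: "uniform_nodes N x" "uniform_nodes N y" "x N - x 0 = y N - y 0"
    and D: "D = dom_rect N x y"
    and g: "continuous_on D g" "\<forall>i\<in>{0, N}. \<forall>j\<in>{0, N}. g (x i, y j) = z i j"
    and h: "continuous_on D h" "\<forall>i\<in>{0..N}. \<forall>j\<in>{0..N}. h (x i, y j) = z i j"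
    and S: "continuous_on D S" "\<forall>t\<in>D. \<bar>S t\<bar> < 1"
    and q: "\<forall>w\<in>letters N. \<forall>t\<in>cell x y w. q t = h t - S t * g (inv_into D (L_map N x y w) t)"
    and f: "continuous_on D f" "\<forall>i\<in>{0..N}. \<forall>j\<in>{0..N}. f (x i, y j) = z i j"
      "surface D f = (\<Union>w\<in>letters N. Psi_map N x y S q w ` surface D f)"
    and S_Lipschitz: "cS > 0" "cS-lipschitz_on D S"
    and q_Lipschitz: "cq > 0" "cq-lipschitz_on D q"
    and S_nonzero: "\<forall>a b c d. a < b \<and> c < d \<and> {a..b} \<times> {c..d} \<subseteq> D \<longrightarrow>
      (\<exists>t\<in>{a..b} \<times> {c..d}. S t \<noteq> 0)"
  shows "upper_box_dim (surface D f)
    \<le> max 2 (1 + elog (rho_star N x y S) / ereal (ln (real N)))"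
proof -
  interpret fractal_surface N x y S q f D cS cq
  proof unfold_locales
    show "\<bar>S t\<bar> \<le> 1" if "t \<in> D" for t using bspec[OF S(2) that] by (rule less_imp_le)
  qed (fact N nodes D f S_Lipschitz q_Lipschitz)+
  show ?thesis
  proof (cases "rho_star N x y S \<le> N")
    case True
    then have "ereal (1 + ln (max N (rho_star N x y S)) / ln N) = 2"
      using N by (simp add: max_absorb1)
    then show ?thesis using upper_box_dim_le_rho_star by (simp add: le_max_iff_disj)
  next
    case False
    then have "elog (rho_star N x y S) = ereal (ln (rho_star N x y S))"
      using N by (simp add: elog_def)
    then have "1 + elog (rho_star N x y S) / ereal (ln N)
        = ereal (1 + ln (max N (rho_star N x y S)) / ln N)"
      using N False by (simp add: max_absorb2 one_ereal_def)
    then show ?thesis using upper_box_dim_le_rho_star by (simp add: le_max_iff_disj)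
  qed
qed

end
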